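(* Let $S$ be a Damek–Ricci space with $\mathfrak{s}=\mathfrak{a}\oplus\mathfrak{v}\oplus\mathfrak{z}$. Let $\mathfrak{w}$ be a linear subspace of the real vector space $\mathfrak{v}$. Then $\mathfrak{h}:=\mathfrak{w}\oplus\mathfrak{z}$ is a subalgebra of $\mathfrak{s}$; let $H$ be the corresponding connected closed subgroup of $S$. Let $Q\subseteq A(N)_0$ be a closed subgroup whose action on $\mathfrak{v}$ leaves $\mathfrak{w}$ invariant. Then the $Q\ltimes L(H)$-action on $S$ is polar if and only if $Q$ acts polarly on the orthogonal complement of $\mathfrak{w}$ in $\mathfrak{v}$ with a section $\ell$ (a linear subspace) such that $J_X\ell\perp\ell$ for all $X\in\mathfrak{z}$.
   Context: Damek–Ricci space: let $\mathfrak{n}=\mathfrak{v}\oplus\mathfrak{z}$ be a real Lie algebra with inner product $\langle\cdot,\cdot\rangle$ such that $\mathfrak{v}\perp\mathfrak{z}$, $[\mathfrak{v},\mathfrak{v}]\subseteq\mathfrak{z}$, $[\mathfrak{v},\mathfrak{z}]=[\mathfrak{z},\mathfrak{z}]=0$; define $J_Z\in\mathrm{End}(\mathfrak{v})$ for $Z\in\mathfrak{z}$ by $\langle J_ZU,V\rangle=\langle[U,V],Z\rangle$ and assume $J_Z^2=-\langle Z,Z\rangle\mathrm{id}_{\mathfrak{v}}$; $N$ is the simply connected Lie group with Lie algebra $\mathfrak{n}$. Let $\mathfrak{a}=\mathbb{R}A$, $\mathfrak{s}=\mathfrak{a}\oplus\mathfrak{n}$ with $[A,U]=\tfrac12U$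 ($U\in\mathfrak{v}$), $[A,X]=X$ ($X\in\mathfrak{z}$), inner product extended with $A$ a unit vector orthogonal to $\mathfrak{n}$; $S$ is the simply connected Lie group with Lie algebra $\mathfrak{s}$ with the induced left-invariant metric. $L(H)$ is the group of left translations of $S$ by elements of $H$. $A(N)$ is the group of automorphisms of $N$ whose differential at the identity is a linear isometry of $\mathfrak{n}$; each extends to an isometric automorphism of $S$ whose differential fixes $A$, so $A(N)$ acts isometrically on $S$ and orthogonally on $\mathfrak{v}$ and $\mathfrak{z}$; $A(N)_0$ is its identity component. $Q\ltimes L(H)$ is the group of isometries of $S$ generated by $Q$ and $L(H)$ ($Q$ normalizes $L(H)$). A proper isometric action of a Lie group $G$ on a Riemannian manifold $M$ is polar if there is a connected closed embedded submanifold $\Sigma$ with $G\cdot\Sigma=M$ and $T_p(G\cdot p)\perp T_p\Sigma$ for all $p\in\Sigma$; for an orthogonal representation, sections can be taken to be linear subspaces. *)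

theory Defs
  imports "HOL-Analysis.Analysis"
begin

fun dderiv :: "'a::real_normed_vector list \<Rightarrow> ('a \<Rightarrow> 'b::real_normed_vector) \<Rightarrow> 'a \<Rightarrow> 'b" where
  "dderiv [] f = f"
| "dderiv (v # vs) f = (\<lambda>x. vector_derivative (\<lambda>t. dderiv vs f (x + t *\<^sub>R v)) (at 0))"

definition smooth_on :: "'a::real_normed_vector set \<Rightarrow> ('a \<Rightarrow> 'b::real_normed_vector) \<Rightarrow> bool" where
  "smooth_on U f \<longleftrightarrow> (\<forall>vs. \<forall>x\<in>U. dderiv vs f differentiable (at x))"

definition embedded_submanifold :: "'a::euclidean_space set \<Rightarrow> bool" where
  "embedded_submanifold M \<longleftrightarrow>
     (\<forall>p\<in>M. \<exists>U V (\<phi>::'a \<Rightarrow> 'a) \<psi> L.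
        open U \<and> p \<in> U \<and> open V \<and> \<phi> ` U = V \<and>
        smooth_on U \<phi> \<and> smooth_on V \<psi> \<and>
        (\<forall>x\<in>U. \<psi> (\<phi> x) = x) \<and> (\<forall>y\<in>V. \<phi> (\<psi> y) = y) \<and>
        subspace L \<and> \<phi> ` (U \<inter> M) = V \<inter> L)"

(* tangent vectors at p of a subset M: velocities of curves in M through p
   (for embedded submanifolds, e.g. orbits of proper actions, this is T_p M) *)
definition tangent_vecs :: "'a::real_normed_vector set \<Rightarrow> 'a \<Rightarrow> 'a set" where
  "tangent_vecs M p = {vector_derivative \<gamma> (at 0) | \<gamma>.
      \<gamma> differentiable (at 0) \<and> \<gamma> 0 = p \<and> (\<forall>t. \<gamma> t \<in> M)}"

(* ---------- Damek--Ricci space in global coordinates ----------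
   A point ((U,X),a) of S stands for exp_N(U+X) \<cdot> exp(aA); on N these are
   exponential coordinates. *)

type_synonym ('v,'z) spt = "('v \<times> 'z) \<times> real"

definition nbr :: "('v \<Rightarrow> 'v \<Rightarrow> 'z) \<Rightarrow> ('v::real_vector \<times> 'z::real_vector) \<Rightarrow> ('v \<times> 'z) \<Rightarrow> ('v \<times> 'z)" where
  "nbr br Y Y' = (0, br (fst Y) (fst Y'))"

definition adA :: "('v::real_vector \<times> 'z::real_vector) \<Rightarrow> ('v \<times> 'z)" where
  "adA Y = ((1/2) *\<^sub>R fst Y, snd Y)"

(* Lie bracket of s = a + n, A = (0,1) *)
definition sbr :: "('v \<Rightarrow> 'v \<Rightarrow> 'z) \<Rightarrow> ('v::real_vector,'z::real_vector) spt \<Rightarrow> ('v,'z) spt \<Rightarrow> ('v,'z) spt" where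
  "sbr br P P' = (nbr br (fst P) (fst P') + snd P *\<^sub>R adA (fst P') - snd P' *\<^sub>R adA (fst P), 0)"

definition subalgebra :: "('v \<Rightarrow> 'v \<Rightarrow> 'z) \<Rightarrow> ('v::real_vector,'z::real_vector) spt set \<Rightarrow> bool" where
  "subalgebra br h \<longleftrightarrow> subspace h \<and> (\<forall>P\<in>h. \<forall>P'\<in>h. sbr br P P' \<in> h)"

definition smult :: "('v \<Rightarrow> 'v \<Rightarrow> 'z) \<Rightarrow> ('v::real_vector,'z::real_vector) spt \<Rightarrow> ('v,'z) spt \<Rightarrow> ('v,'z) spt" where
  "smult br P P' =
     (let U = fst (fst P); X = snd (fst P); a = snd P;
          U' = exp (a/2) *\<^sub>R fst (fst P'); X' = exp a *\<^sub>R snd (fst P'); a' = snd P'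
      in ((U + U', X + X' + (1/2) *\<^sub>R br U U'), a + a'))"

definition sinv :: "('v::real_vector,'z::real_vector) spt \<Rightarrow> ('v,'z) spt" where
  "sinv P = ((- (exp (- snd P / 2) *\<^sub>R fst (fst P)), - (exp (- snd P) *\<^sub>R snd (fst P))), - snd P)"

(* left-invariant metric: pull back to the identity, where A, v, z are orthonormal
   (the product inner product) *)
definition smetric :: "('v \<Rightarrow> 'v \<Rightarrow> 'z) \<Rightarrow> ('v::euclidean_space,'z::euclidean_space) spt
     \<Rightarrow> ('v,'z) spt \<Rightarrow> ('v,'z) spt \<Rightarrow> real" where
  "smetric br p \<xi> \<eta> =
     inner (frechet_derivative (smult br (sinv p)) (at p) \<xi>)
           (frechet_derivative (smult br (sinv p)) (at p) \<eta>)"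

(* A(N): automorphisms of N with isometric differential (in exponential
   coordinates = isometric Lie algebra automorphisms of n) *)
definition AN :: "('v \<Rightarrow> 'v \<Rightarrow> 'z) \<Rightarrow> (('v::euclidean_space \<times> 'z::euclidean_space) \<Rightarrow>\<^sub>L ('v \<times> 'z)) set" where
  "AN br = {\<sigma>. bij (blinfun_apply \<sigma>) \<and> (\<forall>Y. norm (blinfun_apply \<sigma> Y) = norm Y) \<and>
                (\<forall>Y Y'. blinfun_apply \<sigma> (nbr br Y Y') = nbr br (blinfun_apply \<sigma> Y) (blinfun_apply \<sigma> Y'))}"

definition AN0 :: "('v \<Rightarrow> 'v \<Rightarrow> 'z) \<Rightarrow> (('v::euclidean_space \<times> 'z::euclidean_space) \<Rightarrow>\<^sub>L ('v \<times> 'z)) set" where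
  "AN0 br = connected_component_set (AN br) id_blinfun"

(* extension of \<sigma> to an isometric automorphism of S fixing A *)
definition sact :: "(('v::euclidean_space \<times> 'z::euclidean_space) \<Rightarrow>\<^sub>L ('v \<times> 'z)) \<Rightarrow> ('v,'z) spt \<Rightarrow> ('v,'z) spt" where
  "sact \<sigma> P = (blinfun_apply \<sigma> (fst P), snd P)"

definition vact :: "(('v::euclidean_space \<times> 'z::euclidean_space) \<Rightarrow>\<^sub>L ('v \<times> 'z)) \<Rightarrow> 'v \<Rightarrow> 'v" where
  "vact \<sigma> u = fst (blinfun_apply \<sigma> (u, 0))"

(* h = w + z as a subset of s, and H = exp(h) (N is exponential, exp = id in these coordinates) *)
definition hsub :: "'v set \<Rightarrow> ('v::real_vector,'z::real_vector) spt set" where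
  "hsub w = {((U, X), 0) | U X. U \<in> w}"

definition Hgrp :: "'v set \<Rightarrow> ('v::real_vector,'z::real_vector) spt set" where
  "Hgrp w = {((U, X), 0) | U X. U \<in> w}"

definition QH_orbit :: "('v \<Rightarrow> 'v \<Rightarrow> 'z) \<Rightarrow> (('v::euclidean_space \<times> 'z::euclidean_space) \<Rightarrow>\<^sub>L ('v \<times> 'z)) set
     \<Rightarrow> 'v set \<Rightarrow> ('v,'z) spt \<Rightarrow> ('v,'z) spt set" where
  "QH_orbit br Q w p = {sact \<sigma> (smult br h p) | \<sigma> h. \<sigma> \<in> Q \<and> h \<in> Hgrp w}"

definition polar_QH :: "('v \<Rightarrow> 'v \<Rightarrow> 'z) \<Rightarrow> (('v::euclidean_space \<times> 'z::euclidean_space) \<Rightarrow>\<^sub>L ('v \<times> 'z)) set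
     \<Rightarrow> 'v set \<Rightarrow> bool" where
  "polar_QH br Q w \<longleftrightarrow>
     (\<exists>\<Sigma>. connected \<Sigma> \<and> closed \<Sigma> \<and> embedded_submanifold \<Sigma> \<and>
          (\<Union>p\<in>\<Sigma>. QH_orbit br Q w p) = UNIV \<and>
          (\<forall>p\<in>\<Sigma>. \<forall>\<xi>\<in>tangent_vecs (QH_orbit br Q w p) p. \<forall>\<eta>\<in>tangent_vecs \<Sigma> p.
              smetric br p \<xi> \<eta> = 0))"

definition vperp :: "'v::real_inner set \<Rightarrow> 'v set" where
  "vperp w = {u. \<forall>x\<in>w. inner u x = 0}"

definition Q_vorbit :: "(('v::euclidean_space \<times> 'z::euclidean_space) \<Rightarrow>\<^sub>L ('v \<times> 'z)) set \<Rightarrow> 'v \<Rightarrow> 'v set" where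
  "Q_vorbit Q u = {vact \<sigma> u | \<sigma>. \<sigma> \<in> Q}"

definition linear_polar_section :: "(('v::euclidean_space \<times> 'z::euclidean_space) \<Rightarrow>\<^sub>L ('v \<times> 'z)) set
     \<Rightarrow> 'v set \<Rightarrow> 'v set \<Rightarrow> bool" where
  "linear_polar_section Q W l \<longleftrightarrow>
     subspace l \<and> l \<subseteq> W \<and> (\<Union>u\<in>l. Q_vorbit Q u) = W \<and>
     (\<forall>u\<in>l. \<forall>\<xi>\<in>tangent_vecs (Q_vorbit Q u) u. \<forall>\<eta>\<in>l. inner \<xi> \<eta> = 0)"

end

theory Submission
  imports Defs
begin

text \<open>
  Since \<open>H\<close> contains the center of \<open>N\<close>, the orbit of \<open>((U, X), a)\<close> consists of all \<open>((U', X'), a)\<close>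
  for which the projections of \<open>U\<close> and \<open>U'\<close> to \<open>vperp w\<close> lie in one \<open>Q\<close>-orbit. Hence a section
  \<open>\<Sigma>\<close> is a horizontal lift: along \<open>\<Sigma>\<close> the differentials satisfy \<open>dX = (1/2) [U, dU]\<close>,
  \<open>dU \<bottom> w\<close> and \<open>dU \<bottom> B U\<close> for every \<open>B\<close> in the Lie algebra of \<open>Q\<close>. Differentiating these
  identities once more and using the symmetry of second derivatives, all tangent vectors
  \<open>\<zeta>, \<eta>\<close> at one point satisfy \<open>[\<zeta>, \<eta>] = 0\<close> and \<open>B \<zeta> \<bottom> \<eta>\<close>. If the tangent space at some point
  projects onto the whole normal space \<open>\<ell>\<close> of the \<open>Q\<close>-orbit in \<open>vperp w\<close>, then \<open>\<ell>\<close> is the required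
  linear section; every \<open>Q\<close>-orbit meets \<open>\<ell>\<close>, in the point of the orbit closest to the base point.
  Such a point exists: otherwise the translates of \<open>\<Sigma>\<close> near a point of maximal orbit dimension are
  countably many Lipschitz images of sets of dimension smaller than that of \<open>S\<close>, hence negligible.

  The tangent vectors of \<open>Q\<close>-orbits are velocities of curves that are merely differentiable at one
  point; they are controlled because a neighbourhood of the identity in a compact linear group is
  covered by the exponential map.
\<close>

section \<open>Endomorphisms as a Banach algebra\<close>

text \<open>A type of its own, so that composition can serve as the multiplication of a Banach
  algebra; this makes powers and \<open>exp\<close> of operators available.\<close>

typedef (overloaded) 'a endo = "UNIV :: ('a::euclidean_space \<Rightarrow>\<^sub>L 'a) set"
  morphisms blin Endo by simp

setup_lifting type_definition_endo

instantiation endo :: (euclidean_space) real_normed_algebra_1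
begin

lift_definition zero_endo :: "'a endo" is 0 .
lift_definition one_endo :: "'a endo" is id_blinfun .
lift_definition plus_endo :: "'a endo \<Rightarrow> 'a endo \<Rightarrow> 'a endo" is "(+)" .
lift_definition minus_endo :: "'a endo \<Rightarrow> 'a endo \<Rightarrow> 'a endo" is "(-)" .
lift_definition uminus_endo :: "'a endo \<Rightarrow> 'a endo" is uminus .
lift_definition times_endo :: "'a endo \<Rightarrow> 'a endo \<Rightarrow> 'a endo" is "(o\<^sub>L)" .
lift_definition scaleR_endo :: "real \<Rightarrow> 'a endo \<Rightarrow> 'a endo" is "(*\<^sub>R)" .
lift_definition norm_endo :: "'a endo \<Rightarrow> real" is norm .
lift_definition dist_endo :: "'a endo \<Rightarrow> 'a endo \<Rightarrow> real" is dist .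
lift_definition sgn_endo :: "'a endo \<Rightarrow> 'a endo" is sgn .
definition uniformity_endo :: "('a endo \<times> 'a endo) filter"
  where "uniformity_endo = (INF e\<in>{0 <..}. principal {(x, y). dist x y < e})"
definition open_endo :: "'a endo set \<Rightarrow> bool"
  where "open_endo S = (\<forall>x\<in>S. \<forall>\<^sub>F (x', y) in uniformity. x' = x \<longrightarrow> y \<in> S)"

instance
proof
  fix a b c :: "'a endo" and r s :: real and S :: "'a endo set"
  show "a + b + c = a + (b + c)" "a + b = b + a" "0 + a = a" "- a + a = 0" "a - b = a + - b"
    by (transfer; simp)+
  show "r *\<^sub>R (a + b) = r *\<^sub>R a + r *\<^sub>R b" "(r + s) *\<^sub>R a = r *\<^sub>R a + s *\<^sub>R a"
    "r *\<^sub>R s *\<^sub>R a = (r * s) *\<^sub>R a" "1 *\<^sub>R a = a"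
    by (transfer; simp add: algebra_simps)+
  show "a * b * c = a * (b * c)" "(a + b) * c = a * c + b * c" "a * (b + c) = a * b + a * c"
    "r *\<^sub>R a * b = r *\<^sub>R (a * b)" "a * r *\<^sub>R b = r *\<^sub>R (a * b)" "1 * a = a" "a * 1 = a"
    by (transfer; rule blinfun_eqI; simp add: blinfun.bilinear_simps)+
  show "(0::'a endo) \<noteq> 1"
    using norm_blinfun_id[where 'a='a] by transfer (auto simp del: norm_blinfun_id)
  show "dist a b = norm (a - b)" by transfer (rule dist_norm)
  show "sgn a = inverse (norm a) *\<^sub>R a" by transfer (rule sgn_div_norm)
  show "uniformity = (INF e\<in>{0 <..}. principal {(x, y :: 'a endo). dist x y < e})"
    by (rule uniformity_endo_def)
  show "open S = (\<forall>x\<in>S. \<forall>\<^sub>F (x', y) in uniformity. x' = x \<longrightarrow> y \<in> S)"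
    by (rule open_endo_def)
  show "(norm a = 0) = (a = 0)" "norm (a + b) \<le> norm a + norm b" "norm (r *\<^sub>R a) = \<bar>r\<bar> * norm a"
    by (transfer; simp add: norm_triangle_ineq)+
  show "norm (a * b) \<le> norm a * norm b" by transfer (rule norm_blinfun_compose)
  show "norm (1 :: 'a endo) = 1" by transfer simp
qed

end

instance endo :: (euclidean_space) banach
proof
  fix X :: "nat \<Rightarrow> 'a endo"
  assume "Cauchy X"
  then have "Cauchy (\<lambda>n. blin (X n))"
    unfolding Cauchy_def dist_endo.rep_eq .
  then obtain l where "(\<lambda>n. blin (X n)) \<longlonglongrightarrow> l"
    using Cauchy_convergent_iff convergent_def by blast
  then have "X \<longlonglongrightarrow> Endo l"
    by (simp add: tendsto_iff dist_endo.rep_eq Endo_inverse)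
  then show "convergent X" by (auto simp: convergent_def)
qed

text \<open>Finite dimension enters here: the compactness arguments below extract convergent
  subsequences of operators.\<close>

instance endo :: (euclidean_space) heine_borel
proof
  fix f :: "nat \<Rightarrow> 'a endo"
  assume "bounded (range f)"
  then have "bounded (range (\<lambda>n. blin (f n)))"
    unfolding bounded_iff by (simp add: norm_endo.rep_eq)
  then obtain l r where "strict_mono r" "((\<lambda>n. blin (f n)) \<circ> r) \<longlonglongrightarrow> l"
    using bounded_imp_convergent_subsequence by metis
  then have "strict_mono r \<and> (f \<circ> r) \<longlonglongrightarrow> Endo l"
    by (simp add: tendsto_iff dist_endo.rep_eq Endo_inverse)
  then show "\<exists>l r. strict_mono r \<and> (f \<circ> r) \<longlonglongrightarrow> l" by blast
qed

lift_definition app :: "'a::euclidean_space endo \<Rightarrow> 'a \<Rightarrow> 'a" is blinfun_apply .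

lemma bounded_bilinear_app: "bounded_bilinear app"
  by (rule bounded_bilinear.intro; (transfer; simp add: blinfun.bilinear_simps)?)
    (rule exI[of _ 1]; transfer; simp add: norm_blinfun)

interpretation app: bounded_bilinear app
  by (rule bounded_bilinear_app)

lemma norm_app: "norm (app A x) \<le> norm A * norm x"
  by transfer (rule norm_blinfun)

lemma app_mult [simp]: "app (A * B) x = app A (app B x)"
  by transfer simp

lemma app_one [simp]: "app 1 x = x"
  by transfer simp

lemma endo_eqI: "(\<And>x. app A x = app B x) \<Longrightarrow> A = B"
  by transfer (rule blinfun_eqI)

lemma norm_endo_bound: "0 \<le> b \<Longrightarrow> (\<And>x. norm (app A x) \<le> b * norm x) \<Longrightarrow> norm A \<le> b"
  by transfer (rule norm_blinfun_bound)

section \<open>Compact groups of linear isometries\<close>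

text \<open>Telescoping. The hypotheses are asymmetric because \<open>x\<close> will be an isometry,
  while \<open>y\<close> will be an exponential whose powers are bounded only by some
  \<open>C\<close>.\<close>

lemma norm_power_diff_le:
  fixes x y :: "'a::real_normed_algebra_1"
  assumes "norm x \<le> 1" "\<And>j. j < k \<Longrightarrow> norm (y ^ j) \<le> C"
  shows "norm (x ^ k - y ^ k) \<le> real k * (C * norm (x - y))"
  using assms(2)
proof (induction k)
  case (Suc k)
  have "x ^ Suc k - y ^ Suc k = x * (x ^ k - y ^ k) + (x - y) * y ^ k"
    by (simp add: algebra_simps)
  also have "norm \<dots> \<le> norm (x * (x ^ k - y ^ k)) + norm ((x - y) * y ^ k)"
    by (rule norm_triangle_ineq)
  also have "\<dots> \<le> norm x * norm (x ^ k - y ^ k) + norm (x - y) * norm (y ^ k)"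
    by (intro add_mono norm_mult_ineq)
  also have "\<dots> \<le> 1 * norm (x ^ k - y ^ k) + norm (x - y) * C"
    by (intro add_mono mult_right_mono mult_left_mono assms(1) Suc.prems) auto
  also have "\<dots> \<le> real k * (C * norm (x - y)) + norm (x - y) * C"
    using Suc by auto
  finally show ?case by (simp add: algebra_simps)
qed simp

text \<open>The same telescoping with both elements in one ball; the factor \<open>Suc k\<close>
  will cancel against the factorial in the exponential series.\<close>

lemma norm_power_diff_ball:
  fixes x y :: "'a::real_normed_algebra_1"
  assumes "norm x \<le> r" "norm y \<le> r"
  shows "norm (x ^ Suc k - y ^ Suc k) \<le> real (Suc k) * r ^ k * norm (x - y)"
proof (induction k)
  case (Suc k)
  have r: "0 \<le> r" using assms(1) norm_ge_zero order_trans by blast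
  have "x ^ Suc (Suc k) - y ^ Suc (Suc k) = x * (x ^ Suc k - y ^ Suc k) + (x - y) * y ^ Suc k"
    by (simp add: algebra_simps)
  also have "norm \<dots> \<le> norm (x * (x ^ Suc k - y ^ Suc k)) + norm ((x - y) * y ^ Suc k)"
    by (rule norm_triangle_ineq)
  also have "\<dots> \<le> norm x * norm (x ^ Suc k - y ^ Suc k) + norm (x - y) * norm (y ^ Suc k)"
    by (intro add_mono norm_mult_ineq)
  also have "\<dots> \<le> r * (real (Suc k) * r ^ k * norm (x - y)) + norm (x - y) * r ^ Suc k"
  proof (intro add_mono mult_mono Suc.IH assms order_refl)
    show "norm (y ^ Suc k) \<le> r ^ Suc k"
      using norm_power_ineq[of y "Suc k"] power_mono[OF assms(2), of "Suc k"] by simp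
  qed (use r in auto)
  finally show ?case by (simp add: algebra_simps)
qed simp

text \<open>The two exponential series are compared term by term from the quadratic term on, with
  the series of \<open>exp r - 1\<close> as majorant. Near 0, \<open>exp\<close> thus differs from
  the identity by a map with small Lipschitz constant.\<close>

lemma norm_exp_diff_sub_diff:
  fixes x y :: "'a::{real_normed_algebra_1,banach}"
  assumes "norm x \<le> r" "norm y \<le> r"
  shows "norm (exp x - exp y - (x - y)) \<le> (exp r - 1) * norm (x - y)"
proof -
  have split2: "(\<lambda>n. z ^ Suc (Suc n) /\<^sub>R fact (Suc (Suc n))) sums (exp z - 1 - z)"
    for z :: 'a
    using sums_split_initial_segment[OF exp_converges[of z], of 2] by (simp add: eval_nat_numeral algebra_simps)
  have S: "(\<lambda>n. x ^ Suc (Suc n) /\<^sub>R fact (Suc (Suc n)) - y ^ Suc (Suc n) /\<^sub>R fact (Suc (Suc n)))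
      sums ((exp x - 1 - x) - (exp y - 1 - y))"
    by (intro sums_diff split2)
  have R: "(\<lambda>n. r ^ Suc n /\<^sub>R fact (Suc n) * norm (x - y)) sums ((exp r - 1) * norm (x - y))"
    using sums_split_initial_segment[OF exp_converges[of r], of 1] by (intro sums_mult2) simp
  have "norm ((exp x - 1 - x) - (exp y - 1 - y)) \<le> (exp r - 1) * norm (x - y)"
    unfolding sums_unique[OF S] sums_unique[OF R]
  proof (rule norm_suminf_le)
    fix n
    have "norm (x ^ Suc (Suc n) /\<^sub>R fact (Suc (Suc n)) - y ^ Suc (Suc n) /\<^sub>R fact (Suc (Suc n)))
        = norm (x ^ Suc (Suc n) - y ^ Suc (Suc n)) / fact (Suc (Suc n))"
      by (simp add: scaleR_diff_right[symmetric] divide_inverse_commute del: power_Suc fact_Suc)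
    also have "\<dots> \<le> (real (Suc (Suc n)) * r ^ Suc n * norm (x - y)) / fact (Suc (Suc n))"
      by (intro divide_right_mono norm_power_diff_ball assms) simp
    also have "\<dots> = r ^ Suc n /\<^sub>R fact (Suc n) * norm (x - y)"
      by (simp add: fact_Suc[of "Suc n"] field_simps del: power_Suc fact_Suc of_nat_Suc)
    finally show "norm (x ^ Suc (Suc n) /\<^sub>R fact (Suc (Suc n)) - y ^ Suc (Suc n) /\<^sub>R fact (Suc (Suc n)))
        \<le> r ^ Suc n /\<^sub>R fact (Suc n) * norm (x - y)" .
  qed (use R sums_summable in blast)
  then show ?thesis by (simp add: algebra_simps)
qed

lemma exp_near_linear:
  fixes e :: real
  assumes "e > 0"
  obtains d where "d > 0"
    "\<And>x y :: 'a::{real_normed_algebra_1,banach}. norm x \<le> d \<Longrightarrow> norm y \<le> d \<Longrightarrow>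
        norm (exp x - exp y - (x - y)) \<le> e * norm (x - y)"
proof -
  \<comment> \<open>The solution of \<open>exp d - 1 = e\<close>.\<close>
  let ?d = "ln (1 + e)"
  have "norm (exp x - exp y - (x - y)) \<le> e * norm (x - y)"
    if "norm x \<le> ?d" "norm y \<le> ?d" for x y :: 'a
    using norm_exp_diff_sub_diff[OF that] assms by simp
  then show ?thesis using that[of ?d] assms by simp
qed

lemma tendsto_exp_algebra:
  fixes l :: "'a::{real_normed_algebra_1,banach}"
  assumes "(f \<longlongrightarrow> l) F"
  shows "((\<lambda>x. exp (f x)) \<longlongrightarrow> exp l) F"
proof -
  let ?r = "norm l + 1"
  have "((\<lambda>x. exp ?r * norm (f x - l)) \<longlongrightarrow> exp ?r * norm (l - l)) F"
    by (intro tendsto_mult[OF tendsto_const] tendsto_norm tendsto_diff assms tendsto_const)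
  then have lim0: "((\<lambda>x. exp ?r * norm (f x - l)) \<longlongrightarrow> 0) F"
    by simp
  have bound: "norm (exp y - exp l) \<le> exp ?r * norm (y - l)" if "dist y l < 1" for y
  proof -
    have "norm y \<le> ?r" using that norm_triangle_ineq2[of y l] by (simp add: dist_norm)
    from norm_exp_diff_sub_diff[OF this, of l]
    have "norm (exp y - exp l - (y - l)) \<le> (exp ?r - 1) * norm (y - l)" by simp
    then show ?thesis
      using norm_triangle_sub[of "exp y - exp l" "y - l"] by (simp add: algebra_simps)
  qed
  have "((\<lambda>x. exp (f x) - exp l) \<longlongrightarrow> 0) F"
    by (rule Lim_null_comparison[OF eventually_mono[OF tendstoD[OF assms zero_less_one] bound] lim0])
  then show ?thesis by (rule Lim_null[THEN iffD2])
qed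

lemma exp_scaleR_of_nat: "exp (real n *\<^sub>R x) = exp (x::'a::{real_normed_algebra_1,banach}) ^ n"
proof (induction n)
  case (Suc n)
  have "exp (real (Suc n) *\<^sub>R x) = exp (x + real n *\<^sub>R x)" by (simp add: algebra_simps)
  also have "\<dots> = exp x * exp (real n *\<^sub>R x)" by (rule exp_add_commuting) simp
  finally show ?case using Suc by simp
qed simp

lemma vector_derivative_diff_quot:
  assumes "(f has_vector_derivative D) (at 0)"
  shows "((\<lambda>t. (f t - f 0) /\<^sub>R t) \<longlongrightarrow> D) (at 0)"
proof (rule Lim_null[THEN iffD2], rule tendsto_norm_zero_cancel)
  have "((\<lambda>t. norm (f t - (f 0 + t *\<^sub>R D)) / \<bar>t\<bar>) \<longlongrightarrow> 0) (at 0)"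
    using assms unfolding has_vector_derivative_def has_derivative_at2
    by (auto simp: tendsto_iff)
  moreover have "\<forall>\<^sub>F t in at 0. norm (f t - (f 0 + t *\<^sub>R D)) / \<bar>t\<bar> = norm ((f t - f 0) /\<^sub>R t - D)"
  proof (unfold eventually_at_filter, intro always_eventually allI impI)
    fix t :: real
    assume "t \<noteq> 0"
    then have "(f t - f 0) /\<^sub>R t - D = (f t - (f 0 + t *\<^sub>R D)) /\<^sub>R t"
      by (simp add: algebra_simps)
    then show "norm (f t - (f 0 + t *\<^sub>R D)) / \<bar>t\<bar> = norm ((f t - f 0) /\<^sub>R t - D)"
      by (simp add: divide_inverse_commute)
  qed
  ultimately show "((\<lambda>t. norm ((f t - f 0) /\<^sub>R t - D)) \<longlongrightarrow> 0) (at 0)"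
    by (rule Lim_transform_eventually)
qed

lemma vector_derivative_diff_quot_seq:
  assumes "(f has_vector_derivative D) (at 0)" "e \<longlonglongrightarrow> (0::real)" "\<And>n. e n \<noteq> 0"
  shows "(\<lambda>n. (f (e n) - f 0) /\<^sub>R e n) \<longlonglongrightarrow> D"
  using vector_derivative_diff_quot[OF assms(1)] assms(2,3)
  by (auto simp: tendsto_at_iff_sequentially comp_def)

lemma exp_scaleR_diff_quot_seq:
  fixes B :: "'a::{real_normed_algebra_1,banach}" and e :: "nat \<Rightarrow> real"
  assumes "e \<longlonglongrightarrow> 0" "\<And>n. e n \<noteq> 0"
  shows "(\<lambda>n. (exp (e n *\<^sub>R B) - 1) /\<^sub>R e n) \<longlonglongrightarrow> B"
  using vector_derivative_diff_quot_seq[OF exp_scaleR_has_vector_derivative_right[of B 0] assms]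
  by simp

section \<open>The Lie algebra of a compact linear group\<close>

locale compact_isometry_group =
  fixes K :: "'a::euclidean_space endo set"
  assumes compact: "compact K"
    and one: "1 \<in> K"
    and mult: "\<And>S T. S \<in> K \<Longrightarrow> T \<in> K \<Longrightarrow> S * T \<in> K"
    and left_inverse: "\<And>T. T \<in> K \<Longrightarrow> \<exists>S\<in>K. S * T = 1"
    and isometry: "\<And>T x. T \<in> K \<Longrightarrow> norm (app T x) = norm x"
begin

text \<open>Von Neumann's description of the Lie algebra of a closed linear group through its
  one-parameter subgroups; linearity and closedness are proved below.\<close>

definition lie :: "'a endo set"
  where "lie = {B. \<forall>t. exp (t *\<^sub>R B) \<in> K}"

lemma ex_inverse:
  assumes "T \<in> K"
  obtains S where "S \<in> K" "S * T = 1" "T * S = 1"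
proof -
  obtain S S' where S: "S \<in> K" "S * T = 1" and "S' * S = 1"
    using left_inverse assms by metis
  then have "S' = T" by (metis mult.assoc mult_1_left mult_1_right)
  then show ?thesis using S \<open>S' * S = 1\<close> that by blast
qed

lemma inner_app: "T \<in> K \<Longrightarrow> inner (app T x) (app T y) = inner x y"
  using isometry[of T "x + y"] isometry[of T x] isometry[of T y]
  by (simp add: app.add_right norm_eq_sqrt_inner inner_add_left inner_add_right inner_commute)

lemma norm_le_1: "T \<in> K \<Longrightarrow> norm T \<le> 1"
  by (rule norm_endo_bound) (simp_all add: isometry)

lemma power: "T \<in> K \<Longrightarrow> T ^ n \<in> K"
  by (induction n) (simp_all add: one mult)

lemma closed: "closed K"
  using compact compact_imp_closed by blast

lemma exp_lie: "B \<in> lie \<Longrightarrow> exp (t *\<^sub>R B) \<in> K"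
  by (simp add: lie_def)

text \<open>The powers \<open>T n ^ k\<close> with \<open>k e\<^sub>n \<approx> t\<close> lie in \<open>K\<close> and approximate \<open>exp (t B)\<close>.\<close>

lemma lie_limit:
  assumes T: "\<And>n. T n \<in> K" and e: "e \<longlonglongrightarrow> 0" "\<And>n. e n > (0::real)"
    and lim: "(\<lambda>n. (T n - 1) /\<^sub>R e n) \<longlonglongrightarrow> B"
  shows "B \<in> lie"
proof -
  have pos: "exp (t *\<^sub>R B) \<in> K" if t: "t \<ge> 0" for t
  proof -
    define k where "k n = nat \<lfloor>t / e n\<rfloor>" for n
    define C where "C = exp (t * norm B)"
    have k: "real (k n) \<le> t / e n" "t / e n - 1 \<le> real (k n)" for n
    proof -
      have "0 \<le> t / e n" using t e(2)[of n] by simp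
      then show "real (k n) \<le> t / e n" "t / e n - 1 \<le> real (k n)"
        unfolding k_def by linarith+
    qed
    have ke: "real (k n) * e n \<le> t" "t - e n \<le> real (k n) * e n" for n
      using k[of n] e(2)[of n] by (auto simp: field_simps)
    \<comment> \<open>Telescoping costs a factor \<open>k n \<le> t / e n\<close>, which is exactly
      absorbed by passing to the difference quotients of \<open>T n\<close> and
      \<open>exp (e n B)\<close>. Both quotients tend to \<open>B\<close>.\<close>
    have bound: "norm (T n ^ k n - exp (e n *\<^sub>R B) ^ k n)
        \<le> t * (C * norm ((T n - 1) /\<^sub>R e n - (exp (e n *\<^sub>R B) - 1) /\<^sub>R e n))" for n
    proof -
      have "norm (exp (e n *\<^sub>R B) ^ j) \<le> C" if "j < k n" for j
      proof -
        have "norm (exp (e n *\<^sub>R B) ^ j) \<le> exp (norm (real j *\<^sub>R e n *\<^sub>R B))"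
          by (metis exp_scaleR_of_nat norm_exp)
        also have "real j * e n \<le> t"
          using that ke(1)[of n] e(2)[of n]
          by (meson less_imp_le mult_right_mono of_nat_less_iff order_trans)
        then have "exp (norm (real j *\<^sub>R e n *\<^sub>R B)) \<le> C"
          using e(2)[of n] by (simp add: C_def abs_mult mult_right_mono flip: mult.assoc)
        finally show ?thesis .
      qed
      then have "norm (T n ^ k n - exp (e n *\<^sub>R B) ^ k n) \<le> real (k n) * (C * norm (T n - exp (e n *\<^sub>R B)))"
        by (intro norm_power_diff_le norm_le_1 T) auto
      also have "\<dots> \<le> (t / e n) * (C * norm (T n - exp (e n *\<^sub>R B)))"
        by (intro mult_right_mono k) (simp add: C_def)
      also have "\<dots> = t * (C * norm ((T n - exp (e n *\<^sub>R B)) /\<^sub>R e n))"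
        using e(2)[of n] by (simp add: divide_inverse)
      also have "(T n - exp (e n *\<^sub>R B)) /\<^sub>R e n = (T n - 1) /\<^sub>R e n - (exp (e n *\<^sub>R B) - 1) /\<^sub>R e n"
        by (simp add: algebra_simps)
      finally show ?thesis .
    qed
    have dq: "(\<lambda>n. (exp (e n *\<^sub>R B) - 1) /\<^sub>R e n) \<longlonglongrightarrow> B"
      using e by (intro exp_scaleR_diff_quot_seq) (auto simp: less_imp_neq[symmetric])
    have lim0: "(\<lambda>n. t * (C * norm ((T n - 1) /\<^sub>R e n - (exp (e n *\<^sub>R B) - 1) /\<^sub>R e n)))
        \<longlonglongrightarrow> t * (C * norm (B - B))"
      by (intro tendsto_mult[OF tendsto_const] tendsto_norm tendsto_diff lim dq)
    have z: "(\<lambda>n. T n ^ k n - exp (e n *\<^sub>R B) ^ k n) \<longlonglongrightarrow> 0"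
      by (rule Lim_null_comparison[OF always_eventually[OF allI[OF bound]]]) (use lim0 in simp)
    have "(\<lambda>n. real (k n) * e n) \<longlonglongrightarrow> t"
    proof (rule real_tendsto_sandwich)
      show "(\<lambda>n. t - e n) \<longlonglongrightarrow> t" using tendsto_diff[OF tendsto_const e(1), of t] by simp
      show "\<forall>\<^sub>F n in sequentially. t - e n \<le> real (k n) * e n" using ke by (intro always_eventually allI)
      show "\<forall>\<^sub>F n in sequentially. real (k n) * e n \<le> t" using ke by (intro always_eventually allI)
    qed simp
    then have "(\<lambda>n. exp ((real (k n) * e n) *\<^sub>R B)) \<longlonglongrightarrow> exp (t *\<^sub>R B)"
      by (intro tendsto_exp_algebra tendsto_scaleR tendsto_const)
    then have "(\<lambda>n. exp (e n *\<^sub>R B) ^ k n) \<longlonglongrightarrow> exp (t *\<^sub>R B)"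
      by (simp add: exp_scaleR_of_nat[symmetric])
    from tendsto_add[OF z this] have "(\<lambda>n. T n ^ k n) \<longlonglongrightarrow> exp (t *\<^sub>R B)" by simp
    then show ?thesis
      using closed_sequentially[OF closed, of "\<lambda>n. T n ^ k n"] by (simp add: T power)
  qed
  \<comment> \<open>Negative times follow from the existence of inverses in
    \<open>K\<close>.\<close>
  have "exp (t *\<^sub>R B) \<in> K" if t: "t < 0" for t
  proof -
    obtain S where S: "S \<in> K" "S * exp ((-t) *\<^sub>R B) = 1"
      using left_inverse[OF pos, of "-t"] t by auto
    have "exp (-(t *\<^sub>R B)) * exp (t *\<^sub>R B) = 1"
      using exp_minus_inverse[of "-(t *\<^sub>R B)"] by simp
    then have "S = S * exp ((-t) *\<^sub>R B) * exp (t *\<^sub>R B)"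
      by (simp add: mult.assoc)
    then have "S = exp (t *\<^sub>R B)" by (simp only: S(2) mult_1_left)
    then show ?thesis using S by simp
  qed
  then have "exp (t *\<^sub>R B) \<in> K" for t using pos[of t] by (cases "t < 0") auto
  then show ?thesis by (simp add: lie_def)
qed

text \<open>For sums, the curve \<open>exp (t B) * exp (t C)\<close> in \<open>K\<close> has
  velocity \<open>B + C\<close> at 0, so \<open>lie_limit\<close> applies along
  \<open>t = 1 / (n + 1)\<close>.\<close>

lemma subspace_lie: "subspace lie"
proof (rule subspaceI)
  show "0 \<in> lie" by (simp add: lie_def one)
  show "c *\<^sub>R B \<in> lie" if "B \<in> lie" for c B
    using that by (simp add: lie_def)
  show "B + C \<in> lie" if BC: "B \<in> lie" "C \<in> lie" for B C
  proof (rule lie_limit)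
    let ?e = "\<lambda>n. 1 / real (Suc n)"
    show "?e \<longlonglongrightarrow> 0" by (rule lim_1_over_n[THEN LIMSEQ_Suc])
    show "exp (?e n *\<^sub>R B) * exp (?e n *\<^sub>R C) \<in> K" for n
      by (intro mult exp_lie BC)
    have "((\<lambda>t. exp (t *\<^sub>R B) * exp (t *\<^sub>R C)) has_vector_derivative
        exp (0 *\<^sub>R B) * (exp (0 *\<^sub>R C) * C) + (exp (0 *\<^sub>R B) * B) * exp (0 *\<^sub>R C)) (at 0)"
      by (intro has_vector_derivative_mult exp_scaleR_has_vector_derivative_right)
    then have "((\<lambda>t. exp (t *\<^sub>R B) * exp (t *\<^sub>R C)) has_vector_derivative B + C) (at 0)"
      by (simp add: add.commute)
    from vector_derivative_diff_quot_seq[OF this \<open>?e \<longlonglongrightarrow> 0\<close>]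
    show "(\<lambda>n. (exp (?e n *\<^sub>R B) * exp (?e n *\<^sub>R C) - 1) /\<^sub>R ?e n) \<longlonglongrightarrow> B + C"
      by simp
  qed simp
qed

lemma closed_lie: "closed lie"
  unfolding closed_sequential_limits
proof -
  show "\<forall>x l. (\<forall>n. x n \<in> lie) \<and> x \<longlonglongrightarrow> l \<longrightarrow> l \<in> lie"
  proof (intro allI impI)
    fix B l
    assume B: "(\<forall>n. B n \<in> lie) \<and> B \<longlonglongrightarrow> l"
    show "l \<in> lie"
      unfolding lie_def
    proof (intro CollectI allI)
      fix t
      have "(\<lambda>n. exp (t *\<^sub>R B n)) \<longlonglongrightarrow> exp (t *\<^sub>R l)"
        using B by (intro tendsto_exp_algebra tendsto_scaleR tendsto_const) auto
      then show "exp (t *\<^sub>R l) \<in> K"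
        using closed_sequentially[OF closed, of "\<lambda>n. exp (t *\<^sub>R B n)"] B by (simp add: exp_lie)
    qed
  qed
qed

end

section \<open>The exponential map near the identity\<close>

text \<open>Every term of the remainder ends in \<open>app B u\<close>, so the error is relative to
  the velocity \<open>app B u\<close> and not to \<open>norm B * norm u\<close>. This matters when
  \<open>B\<close> almost fixes \<open>u\<close>.\<close>

lemma norm_app_exp_sub:
  fixes B :: "'a::euclidean_space endo"
  shows "norm (app (exp B) u - u - app B u) \<le> (exp (norm B) - 1) * norm (app B u)"
proof -
  have "(\<lambda>n. B ^ Suc (Suc n) /\<^sub>R fact (Suc (Suc n))) sums (exp B - 1 - B)"
    using sums_split_initial_segment[OF exp_converges[of B], of 2]
    by (simp add: eval_nat_numeral algebra_simps)
  from bounded_linear.sums[OF app.bounded_linear_left this, of u]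
  have S: "(\<lambda>n. app (B ^ Suc (Suc n) /\<^sub>R fact (Suc (Suc n))) u) sums (app (exp B) u - u - app B u)"
    by (simp add: app.diff_left)
  have R: "(\<lambda>n. norm B ^ Suc n /\<^sub>R fact (Suc n) * norm (app B u)) sums ((exp (norm B) - 1) * norm (app B u))"
    using sums_split_initial_segment[OF exp_converges[of "norm B"], of 1] by (intro sums_mult2) simp
  show ?thesis
    unfolding sums_unique[OF S] sums_unique[OF R]
  proof (rule norm_suminf_le)
    fix n
    have "norm (app (B ^ Suc (Suc n) /\<^sub>R fact (Suc (Suc n))) u)
        = norm (app (B ^ Suc n) (app B u)) / fact (Suc (Suc n))"
      by (simp only: app.scaleR_left power_Suc2[of B "Suc n"] app_mult norm_scaleR) (simp add: divide_inverse_commute)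
    also have "\<dots> \<le> (norm B ^ Suc n * norm (app B u)) / fact (Suc n)"
    proof (rule frac_le)
      show "norm (app (B ^ Suc n) (app B u)) \<le> norm B ^ Suc n * norm (app B u)"
        using norm_app[of "B ^ Suc n" "app B u"] norm_power_ineq[of B "Suc n"]
        by (meson mult_right_mono norm_ge_zero order_trans)
      show "fact (Suc n) \<le> (fact (Suc (Suc n)) :: real)" by (rule fact_mono) simp
    qed simp_all
    finally show "norm (app (B ^ Suc (Suc n) /\<^sub>R fact (Suc (Suc n))) u)
        \<le> norm B ^ Suc n /\<^sub>R fact (Suc n) * norm (app B u)"
      by (simp add: divide_inverse_commute)
  qed (use R sums_summable in blast)
qed

lemma app_exp_near:
  assumes "e > 0"
  obtains d where "d > 0"
    "\<And>(B :: 'a::euclidean_space endo) u. norm B \<le> d \<Longrightarrow> norm (app (exp B) u - u - app B u) \<le> e * norm (app B u)"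
proof -
  have "norm (app (exp B) u - u - app B u) \<le> e * norm (app B u)" if "norm B \<le> ln (1 + e)"
    for B :: "'a endo" and u
  proof -
    have "exp (norm B) \<le> 1 + e" using that assms by (metis add_pos_pos exp_le_cancel_iff exp_ln zero_less_one)
    then have "(exp (norm B) - 1) * norm (app B u) \<le> e * norm (app B u)" by (intro mult_right_mono) auto
    then show ?thesis using norm_app_exp_sub[of B u] by linarith
  qed
  then show ?thesis using that[of "ln (1 + e)"] assms by simp
qed

context compact_isometry_group
begin

text \<open>If \<open>T\<close> near \<open>1\<close> were not an exponential, the residual direction \<open>(T - exp B) / norm (T - exp B)\<close>
  at the best approximation \<open>exp B\<close> would in the limit be an element of \<open>lie\<close>, along which \<open>B\<close>
  could be improved.\<close>

lemma exp_locally_onto: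
  assumes "r > 0"
  obtains d where "d > 0" "\<And>T. T \<in> K \<Longrightarrow> norm (T - 1) < d \<Longrightarrow> \<exists>B\<in>lie. norm B \<le> r \<and> T = exp B"
proof -
  obtain r0 where r0: "r0 > 0" and near: "\<And>x y :: 'a endo. norm x \<le> r0 \<Longrightarrow> norm y \<le> r0 \<Longrightarrow>
      norm (exp x - exp y - (x - y)) \<le> (1/4) * norm (x - y)"
    by (rule exp_near_linear[of "1/4"]) auto
  define q where "q = min r r0"
  have q: "q > 0" "q \<le> r" "q \<le> r0" using assms r0 by (auto simp: q_def)
  define D where "D = lie \<inter> cball 0 q"
  have D: "compact D" "0 \<in> D"
    using closed_lie q subspace_0[OF subspace_lie] by (auto simp: D_def intro: closed_Int_compact)
  have "\<exists>d>0. \<forall>T\<in>K. norm (T - 1) < d \<longrightarrow> (\<exists>B\<in>D. T = exp B)"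
  proof (rule ccontr)
    assume "\<not> ?thesis"
    then have "\<forall>n. \<exists>T\<in>K. norm (T - 1) < 1 / real (Suc n) \<and> (\<forall>B\<in>D. T \<noteq> exp B)"
      by (metis of_nat_0_less_iff zero_less_Suc zero_less_divide_1_iff)
    then obtain T where T: "\<And>n. T n \<in> K" "\<And>n. norm (T n - 1) < 1 / real (Suc n)"
      "\<And>n B. B \<in> D \<Longrightarrow> T n \<noteq> exp B" by metis
    have T1: "(\<lambda>n. norm (T n - 1)) \<longlonglongrightarrow> 0"
      by (rule real_tendsto_sandwich[OF _ _ tendsto_const lim_1_over_n[THEN LIMSEQ_Suc]])
        (use T(2) in \<open>auto intro!: always_eventually less_imp_le\<close>)
    have "\<exists>B\<in>D. \<forall>C\<in>D. norm (T n - exp B) \<le> norm (T n - exp C)" for n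
    proof (rule continuous_attains_inf)
      show "continuous_on D (\<lambda>B. norm (T n - exp B))"
        unfolding continuous_on_def
        by (intro ballI tendsto_norm tendsto_diff tendsto_const tendsto_exp_algebra tendsto_ident_at)
    qed (use D in auto)
    then obtain B where B: "\<And>n. B n \<in> D" "\<And>n C. C \<in> D \<Longrightarrow> norm (T n - exp (B n)) \<le> norm (T n - exp C)"
      by metis
    define e where "e n = norm (T n - exp (B n))" for n
    have e_pos: "e n > 0" for n using T(3)[OF B(1)] by (simp add: e_def)
    have e_le: "e n \<le> norm (T n - 1)" for n using B(2)[OF D(2)] by (simp add: e_def)
    have e0: "e \<longlonglongrightarrow> 0"
      by (rule real_tendsto_sandwich[OF _ _ tendsto_const T1])
        (use e_pos e_le in \<open>auto intro!: always_eventually less_imp_le\<close>)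
    have Bq: "norm (B n) \<le> q" "B n \<in> lie" for n using B(1)[of n] by (auto simp: D_def)
    \<comment> \<open>\<open>exp\<close> is almost an isometry near 0, so the best approximations
      \<open>B n\<close> tend to 0. They eventually stay away from the boundary of the ball
      \<open>D\<close>, which leaves room for improving them.\<close>
    have B_le: "norm (B n) \<le> 4 * norm (T n - 1)" for n
    proof -
      have "norm (exp (B n) - exp 0 - (B n - 0)) \<le> (1/4) * norm (B n - 0)"
        by (rule near) (use Bq[of n] q r0 in auto)
      then have "norm (exp (B n) - 1 - B n) \<le> (1/4) * norm (B n)" by simp
      moreover have "norm (exp (B n) - 1) \<le> e n + norm (T n - 1)"
        using norm_triangle_ineq4[of "T n - 1" "T n - exp (B n)"] by (simp add: e_def algebra_simps)
      moreover have "norm (B n) \<le> norm (exp (B n) - 1) + norm (exp (B n) - 1 - B n)"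
        using norm_triangle_ineq4[of "exp (B n) - 1" "exp (B n) - 1 - B n"] by simp
      ultimately have "norm (B n) \<le> 2 * norm (T n - 1) + (1/4) * norm (B n)"
        using e_le[of n] by linarith
      then show ?thesis using norm_ge_zero[of "T n - 1"] norm_ge_zero[of "B n"] by linarith
    qed
    have B0: "B \<longlonglongrightarrow> 0"
      by (rule Lim_null_comparison[OF always_eventually[OF allI[OF B_le]]])
        (use tendsto_mult[OF tendsto_const T1, of 4] in simp)
    define M where "M n = (T n - exp (B n)) /\<^sub>R e n" for n
    have M1: "norm (M n) = 1" for n using e_pos[of n] by (simp add: M_def e_def)
    then have "bounded (range M)" by (auto simp: bounded_iff intro!: exI[of _ 1])
    then obtain L s where s: "strict_mono s" "(M \<circ> s) \<longlonglongrightarrow> L"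
      using bounded_imp_convergent_subsequence by blast
    have es: "(\<lambda>n. e (s n)) \<longlonglongrightarrow> 0"
      using LIMSEQ_subseq_LIMSEQ[OF e0 s(1)] by (simp add: comp_def)
    have Bs: "(\<lambda>n. B (s n)) \<longlonglongrightarrow> 0"
      using LIMSEQ_subseq_LIMSEQ[OF B0 s(1)] by (simp add: comp_def)
    have "(\<lambda>n. exp (- B (s n)) * M (s n)) \<longlonglongrightarrow> exp (- 0) * L"
      using s(2) Bs by (intro tendsto_mult tendsto_exp_algebra tendsto_minus) (simp_all add: comp_def)
    \<comment> \<open>Translating the residual direction back to the identity turns it into a
      difference quotient of elements of \<open>K\<close>, to which \<open>lie_limit\<close>
      applies.\<close>
    moreover have "exp (- B n) * M n = (exp (- B n) * T n - 1) /\<^sub>R e n" for n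
      using exp_minus_inverse[of "- B n"] by (simp add: M_def algebra_simps)
    ultimately have lim: "(\<lambda>n. (exp (- B (s n)) * T (s n) - 1) /\<^sub>R e (s n)) \<longlonglongrightarrow> L" by simp
    have "exp (- B n) \<in> K" for n using exp_lie[where t="-1", OF Bq(2)] by simp
    then have L: "L \<in> lie"
      using T(1) e_pos by (intro lie_limit[OF _ es _ lim] mult) auto
    have Ln: "norm L = 1"
      using LIMSEQ_unique[OF tendsto_norm[OF s(2)], of 1] M1 by (simp add: comp_def)
    have "\<forall>\<^sub>F n in sequentially. norm (M (s n) - L) < 1/4"
      using tendstoD[OF s(2), of "1/4"] by (simp add: dist_norm)
    moreover have "\<forall>\<^sub>F n in sequentially. norm (B (s n)) < q / 2"
      using tendstoD[OF Bs, of "q/2"] q by simp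
    moreover have "\<forall>\<^sub>F n in sequentially. e (s n) < q / 2"
      using order_tendstoD(2)[OF es, of "q/2"] q by simp
    ultimately have "\<forall>\<^sub>F n in sequentially. False"
    proof eventually_elim
      case (elim n)
      let ?m = "s n"
      \<comment> \<open>A competitor in \<open>D\<close>. Its distance to \<open>T\<close> is at
        most \<open>e / 4\<close> from replacing the residual direction by \<open>L\<close>, plus
        \<open>e / 4\<close> from the nonlinearity of \<open>exp\<close>, hence less than the
        minimal distance \<open>e\<close>.\<close>
      let ?C = "B ?m + e ?m *\<^sub>R L"
      have nC: "norm ?C \<le> q"
        using norm_triangle_ineq[of "B ?m" "e ?m *\<^sub>R L"] elim e_pos[of ?m] Ln by simp
      have C: "?C \<in> D"
        using nC Bq(2) L subspace_lie by (simp add: D_def subspace_add subspace_scale)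
      have 1: "norm (exp ?C - exp (B ?m) - (?C - B ?m)) \<le> (1/4) * norm (?C - B ?m)"
        by (rule near) (use Bq[of ?m] nC q in auto)
      have "T ?m - exp (B ?m) - e ?m *\<^sub>R L = e ?m *\<^sub>R (M ?m - L)"
        using e_pos[of ?m] by (simp add: M_def algebra_simps)
      then have 2: "norm (T ?m - exp (B ?m) - e ?m *\<^sub>R L) \<le> e ?m * (1/4)"
        using elim(1) e_pos[of ?m] by (simp add: mult_left_mono)
      have "T ?m - exp ?C = (T ?m - exp (B ?m) - e ?m *\<^sub>R L) - (exp ?C - exp (B ?m) - (?C - B ?m))"
        by simp
      then have "norm (T ?m - exp ?C) \<le> norm (T ?m - exp (B ?m) - e ?m *\<^sub>R L) + norm (exp ?C - exp (B ?m) - (?C - B ?m))"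
        by (metis norm_triangle_ineq4)
      also have "\<dots> \<le> e ?m * (1/4) + (1/4) * e ?m"
        using 1 2 e_pos[of ?m] Ln by simp
      finally have "norm (T ?m - exp ?C) < e ?m" using e_pos[of ?m] by simp
      moreover have "e ?m \<le> norm (T ?m - exp ?C)" using B(2)[OF C] by (simp add: e_def)
      ultimately show False by simp
    qed
    then show False by simp
  qed
  then show ?thesis using that q(2) by (force simp: D_def)
qed

section \<open>Tangent spaces of orbits\<close>

text \<open>The tangent space at \<open>u\<close> of the orbit of \<open>u\<close>, obtained by
  evaluating the Lie algebra at \<open>u\<close>.\<close>

definition lie_orbit :: "'a \<Rightarrow> 'a set"
  where "lie_orbit u = (\<lambda>B. app B u) ` lie"

lemma subspace_lie_orbit: "subspace (lie_orbit u)"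
  unfolding lie_orbit_def
  using app.bounded_linear_left bounded_linear.linear linear_subspace_image subspace_lie by blast

text \<open>The group elements realising \<open>\<gamma>\<close> may be chosen wildly. Along a
  sequence of times they converge to an element of the stabilizer of \<open>u\<close>; dividing by
  it leaves elements near 1, which are exponentials. The displacement of \<open>u\<close> is then
  close to some \<open>app B u\<close>, which is orthogonal to \<open>y\<close>.\<close>

lemma orbit_tangent_orthogonal:
  assumes \<gamma>: "\<And>t. \<exists>T\<in>K. \<gamma> t = app T u" "\<gamma> 0 = u" "(\<gamma> has_vector_derivative D) (at 0)"
    and y: "\<And>B. B \<in> lie \<Longrightarrow> inner (app B u) y = 0"
  shows "inner D y = 0"
proof -
  obtain T where T: "\<And>t. T t \<in> K" "\<And>t. \<gamma> t = app (T t) u" using \<gamma>(1) by metis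
  define e where "e n = 1 / real (Suc n)" for n
  have e: "e \<longlonglongrightarrow> 0" "\<And>n. e n > 0"
    using lim_1_over_n[where 'a=real, THEN LIMSEQ_Suc] by (simp_all add: e_def[abs_def])
  obtain S s where s: "S \<in> K" "strict_mono s" "((\<lambda>n. T (e n)) \<circ> s) \<longlonglongrightarrow> S"
    using compact T(1) unfolding compact_def by metis
  define f where "f n = e (s n)" for n
  have f: "f \<longlonglongrightarrow> 0" "\<And>n. f n > 0"
    using LIMSEQ_subseq_LIMSEQ[OF e(1) s(2)] e(2) by (simp_all add: f_def[abs_def] comp_def)
  have Ts: "(\<lambda>n. T (f n)) \<longlonglongrightarrow> S" using s(3) by (simp add: f_def comp_def)
  define x where "x n = (\<gamma> (f n) - u) /\<^sub>R f n" for n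
  have x: "x \<longlonglongrightarrow> D"
    unfolding x_def using vector_derivative_diff_quot_seq[OF \<gamma>(3) f(1)] f(2) \<gamma>(2)
    by (auto simp: less_imp_neq[symmetric])
  have "isCont \<gamma> 0" using \<gamma>(3) has_vector_derivative_continuous by blast
  then have g0: "(\<lambda>n. \<gamma> (f n)) \<longlonglongrightarrow> u"
    using isCont_tendsto_compose[OF _ f(1)] \<gamma>(2) by fastforce
  \<comment> \<open>The limit \<open>S\<close> fixes \<open>u\<close>. With \<open>S'\<close>
    inverse to \<open>S\<close>, the element \<open>T (f n) * S'\<close> moves \<open>u\<close> to
    the same point as \<open>T (f n)\<close> does, and it tends to 1.\<close>
  have "(\<lambda>n. app (T (f n)) u) \<longlonglongrightarrow> app S u"
    by (intro app.tendsto Ts tendsto_const)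
  then have Su: "app S u = u" using g0 T(2) LIMSEQ_unique by auto
  obtain S' where S': "S' \<in> K" "S' * S = 1" "S * S' = 1" using ex_inverse[OF s(1)] .
  have "(\<lambda>n. T (f n) * S' - 1) \<longlonglongrightarrow> S * S' - 1"
    by (intro tendsto_intros Ts)
  then have T'0: "(\<lambda>n. T (f n) * S' - 1) \<longlonglongrightarrow> 0" using S' by simp
  have S'u: "app S' u = u" using S'(2) Su by (metis app_mult app_one)
  have bound: "\<bar>inner D y\<bar> \<le> 2 * c * norm D * norm y" if c: "0 < c" "c \<le> 1/2" for c
  proof -
    obtain r where r: "r > 0" "\<And>(B :: 'a endo) u. norm B \<le> r \<Longrightarrow> norm (app (exp B) u - u - app B u) \<le> c * norm (app B u)"
      using app_exp_near c(1) by blast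
    obtain d where d: "d > 0" "\<And>T. T \<in> K \<Longrightarrow> norm (T - 1) < d \<Longrightarrow> \<exists>B\<in>lie. norm B \<le> r \<and> T = exp B"
      using exp_locally_onto[OF r(1)] by blast
    have "\<forall>\<^sub>F n in sequentially. \<bar>inner (x n) y\<bar> \<le> 2 * c * norm (x n) * norm y"
      using tendstoD[OF T'0 d(1)]
    proof eventually_elim
      case (elim n)
      then obtain B where B: "B \<in> lie" "norm B \<le> r" "T (f n) * S' = exp B"
        using d(2)[OF mult[OF T(1) S'(1)]] by auto
      have g: "\<gamma> (f n) = app (exp B) u" using T(2)[of "f n"] S'u by (simp flip: B(3))
      have *: "norm (\<gamma> (f n) - u - app B u) \<le> c * norm (app B u)"
        using r(2)[OF B(2)] by (simp add: g)
      \<comment> \<open>The error is at most half of the velocity \<open>app B u\<close>, so the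
        velocity is at most twice the displacement, and the error can be measured by the
        displacement instead.\<close>
      have "c * norm (app B u) \<le> (1/2) * norm (app B u)" using c by (intro mult_right_mono) auto
      moreover have "norm (app B u) \<le> norm (\<gamma> (f n) - u) + norm (\<gamma> (f n) - u - app B u)"
        using norm_triangle_ineq4[of "\<gamma> (f n) - u" "\<gamma> (f n) - u - app B u"] by simp
      ultimately have "norm (app B u) \<le> 2 * norm (\<gamma> (f n) - u)" using * by linarith
      then have "c * norm (app B u) \<le> c * (2 * norm (\<gamma> (f n) - u))" using c by (intro mult_left_mono) auto
      with * have **: "norm (\<gamma> (f n) - u - app B u) \<le> c * (2 * norm (\<gamma> (f n) - u))" by linarith
      have "\<bar>inner (\<gamma> (f n) - u) y\<bar> = \<bar>inner (\<gamma> (f n) - u - app B u) y\<bar>"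
        using y[OF B(1)] by (simp add: inner_diff_left)
      also have "\<dots> \<le> norm (\<gamma> (f n) - u - app B u) * norm y" by (rule Cauchy_Schwarz_ineq2)
      also have "\<dots> \<le> c * (2 * norm (\<gamma> (f n) - u)) * norm y" by (intro mult_right_mono ** norm_ge_zero)
      finally have "\<bar>inner (\<gamma> (f n) - u) y\<bar> / f n \<le> c * (2 * norm (\<gamma> (f n) - u)) * norm y / f n"
        using f(2)[of n] by (intro divide_right_mono) auto
      then show ?case
        using f(2)[of n] by (simp add: x_def abs_mult divide_inverse_commute mult_ac)
    qed
    then show ?thesis
      by (rule tendsto_le[OF sequentially_bot, rotated 2]) (intro tendsto_intros x)+
  qed
  show ?thesis
  proof (rule ccontr)
    assume "inner D y \<noteq> 0"
    then have "D \<noteq> 0" "y \<noteq> 0" by auto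
    then have nz: "norm D * norm y > 0" by simp
    have pos: "\<bar>inner D y\<bar> > 0" using \<open>inner D y \<noteq> 0\<close> by simp
    \<comment> \<open>With this \<open>c\<close> the bound would be at most half of the positive
      number \<open>\<bar>inner D y\<bar>\<close>.\<close>
    define c where "c = min (1/2) (\<bar>inner D y\<bar> / (4 * (norm D * norm y)))"
    have "0 < c" "c \<le> 1/2" "c \<le> \<bar>inner D y\<bar> / (4 * (norm D * norm y))"
      using nz pos by (auto simp: c_def)
    then have "c * (4 * (norm D * norm y)) \<le> \<bar>inner D y\<bar>"
      using nz by (simp only: pos_le_divide_eq)
    moreover have "\<bar>inner D y\<bar> \<le> 2 * (c * (norm D * norm y))"
      using bound[of c] \<open>0 < c\<close> \<open>c \<le> 1/2\<close> by (simp only: mult.assoc)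
    ultimately show False using pos by linarith
  qed
qed

text \<open>Near a point \<open>u\<^sub>0\<close> of maximal orbit dimension, the orbits are locally graphs over the
  tangent space of the orbit of \<open>u\<^sub>0\<close>.\<close>

lemma orbit_graph:
  fixes P :: "'a \<Rightarrow> 'a"
  assumes max: "\<And>u. u \<in> A \<Longrightarrow> dim (lie_orbit u) \<le> dim (lie_orbit u0)"
    and P: "linear P" "\<And>x. norm (P x) \<le> norm x" "\<And>x. x \<in> lie_orbit u0 \<Longrightarrow> P x = x"
  obtains r d where "r > 0" "d > 0"
    "\<And>u T. u \<in> A \<Longrightarrow> norm (u - u0) < r \<Longrightarrow> T \<in> K \<Longrightarrow> norm (T - 1) < d \<Longrightarrow>
       norm (app T u - u) \<le> 5 * norm (P (app T u - u))"
    "\<And>u. u \<in> A \<Longrightarrow> norm (u - u0) < r \<Longrightarrow> dim (lie_orbit u) = dim (lie_orbit u0)"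
proof -
  have lin: "linear (\<lambda>B. app B u)" for u
    using app.bounded_linear_left bounded_linear.linear by blast
  \<comment> \<open>A linear choice of generators: \<open>g v\<close> has velocity \<open>v\<close>
    at \<open>u0\<close>. On the ball of radius \<open>1 / (4 c)\<close> around \<open>u0\<close>
    the velocity of \<open>g v\<close> changes by at most \<open>norm v / 4\<close>.\<close>
  obtain g where g: "range g \<subseteq> lie" "linear g" "\<And>v. v \<in> lie_orbit u0 \<Longrightarrow> app (g v) u0 = v"
    using linear_exists_right_inverse_on[OF lin subspace_lie, of u0] unfolding lie_orbit_def by blast
  obtain c where c: "c > 0" "\<And>x. norm (g x) \<le> c * norm x"
    using linear_bounded_pos[OF g(2)] by blast
  define r where "r = 1 / (4 * c)"
  have r: "r > 0" using c by (simp add: r_def)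
  obtain s where s: "s > 0" "\<And>(B :: 'a endo) u. norm B \<le> s \<Longrightarrow> norm (app (exp B) u - u - app B u) \<le> (1/4) * norm (app B u)"
    using app_exp_near[of "1/4"] by auto
  obtain d where d: "d > 0" "\<And>T. T \<in> K \<Longrightarrow> norm (T - 1) < d \<Longrightarrow> \<exists>B\<in>lie. norm B \<le> s \<and> T = exp B"
    using exp_locally_onto[OF s(1)] by blast
  define h where "h u v = app (g v) u" for u v
  have main: "h u ` lie_orbit u0 = lie_orbit u \<and> dim (lie_orbit u) = dim (lie_orbit u0) \<and>
      (\<forall>v\<in>lie_orbit u0. norm (h u v - v) \<le> norm v / 4)"
    if u: "u \<in> A" "norm (u - u0) < r" for u
  proof -
    have h: "linear (h u)"
      unfolding h_def[abs_def] using linear_compose[OF g(2) lin[of u]] by (simp add: comp_def)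
    have near: "norm (h u v - v) \<le> norm v / 4" if "v \<in> lie_orbit u0" for v
    proof -
      have "h u v - v = app (g v) (u - u0)" using g(3)[OF that] by (simp add: h_def app.diff_right)
      then have "norm (h u v - v) \<le> norm (g v) * norm (u - u0)" using norm_app by metis
      also have "\<dots> \<le> (c * norm v) * r" using u(2) c(1) by (intro mult_mono c(2)) auto
      finally show ?thesis using c(1) by (simp add: r_def)
    qed
    have inj: "inj_on (h u) (span (lie_orbit u0))"
      unfolding linear_inj_on_iff_eq_0[OF h subspace_span]
    proof (intro ballI impI)
      fix v assume "v \<in> span (lie_orbit u0)" "h u v = 0"
      then have "norm v \<le> norm v / 4"
        using near[of v] subspace_lie_orbit[of u0] by (simp add: span_eq_iff[THEN iffD2])
      then have "norm v = 0" using norm_ge_zero[of v] by linarith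
      then show "v = 0" by simp
    qed
    \<comment> \<open>Injectivity of \<open>h u\<close> gives one inequality of dimensions,
      maximality at \<open>u0\<close> the other.\<close>
    have "h u ` lie_orbit u0 = lie_orbit u"
    proof (rule subspace_dim_equal)
      show "subspace (h u ` lie_orbit u0)" using h subspace_lie_orbit linear_subspace_image by blast
      show "h u ` lie_orbit u0 \<subseteq> lie_orbit u" using g(1) by (auto simp: h_def lie_orbit_def)
      show "dim (lie_orbit u) \<le> dim (h u ` lie_orbit u0)"
        using max[OF u(1)] dim_image_eq[OF h inj] by simp
    qed (rule subspace_lie_orbit)
    then show ?thesis using dim_image_eq[OF h inj] near by simp
  qed
  have "norm (app T u - u) \<le> 5 * norm (P (app T u - u))"
    if u: "u \<in> A" "norm (u - u0) < r" and T: "T \<in> K" "norm (T - 1) < d" for u T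
  proof -
    have near: "norm (h u v - v) \<le> norm v / 4" if "v \<in> lie_orbit u0" for v
      using main[OF u] that by blast
    obtain B where B: "B \<in> lie" "norm B \<le> s" "T = exp B" using d(2)[OF T] by blast
    then have "app B u \<in> h u ` lie_orbit u0"
      using main[OF u] by (simp add: lie_orbit_def[of u])
    then obtain v where v: "v \<in> lie_orbit u0" "app B u = h u v" by blast
    have Tu: "norm (app T u - u - h u v) \<le> norm (h u v) / 4" using s(2)[OF B(2), of u] B(3) v(2) by simp
    have 1: "norm (h u v) \<le> norm v + norm (h u v - v)"
      using norm_triangle_ineq[of v "h u v - v"] by simp
    have 2: "norm (app T u - u) \<le> norm (h u v) + norm (app T u - u - h u v)"
      using norm_triangle_ineq[of "h u v" "app T u - u - h u v"] by simp
    have "P (app T u - u) = v + P (h u v - v) + P (app T u - u - h u v)"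
      using P(3)[OF v(1)] by (simp add: linear_diff[OF P(1)])
    then have "norm v \<le> norm (P (app T u - u)) + norm (P (h u v - v)) + norm (P (app T u - u - h u v))"
      using norm_triangle_ineq4[of "P (app T u - u) - P (h u v - v)" "P (app T u - u - h u v)"]
        norm_triangle_ineq4[of "P (app T u - u)" "P (h u v - v)"] by (simp add: algebra_simps)
    then have 3: "norm v \<le> norm (P (app T u - u)) + norm (h u v - v) + norm (app T u - u - h u v)"
      using P(2)[of "h u v - v"] P(2)[of "app T u - u - h u v"] by linarith
    \<comment> \<open>With \<open>p = norm (P (app T u - u))\<close>, the estimates give
      \<open>norm v \<le> p + (1/4 + 5/16) * norm v\<close>, so
      \<open>norm v \<le> (16/7) * p\<close>. The displacement is at most
      \<open>(25/16) * norm v \<le> (25/7) * p\<close>, which is below \<open>5 * p\<close>.\<close>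
    show ?thesis using 1 2 3 Tu near[OF v(1)] norm_ge_zero[of "P (app T u - u)"] by linarith
  qed
  then show ?thesis using that r d(1) main by blast
qed

end

section \<open>Invariance properties and normal spaces\<close>

context compact_isometry_group
begin

lemma app_lie_has_vector_derivative:
  "((\<lambda>t. app (exp (t *\<^sub>R B)) u) has_vector_derivative app B u) (at 0)"
  using bounded_linear.has_vector_derivative[OF app.bounded_linear_left[of u]
      exp_scaleR_has_vector_derivative_right[of B 0 UNIV]] by simp

text \<open>Differentiate the invariance of the inner product along
  \<open>exp (t B)\<close>.\<close>

lemma lie_skew:
  assumes "B \<in> lie"
  shows "inner (app B x) y = - inner x (app B y)"
proof -
  have "((\<lambda>t. inner (app (exp (t *\<^sub>R B)) x) (app (exp (t *\<^sub>R B)) y)) has_vector_derivative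
      inner (app (exp (0 *\<^sub>R B)) x) (app B y) + inner (app B x) (app (exp (0 *\<^sub>R B)) y)) (at 0)"
    by (intro bounded_bilinear.has_vector_derivative[OF bounded_bilinear_inner] app_lie_has_vector_derivative)
  then have "((\<lambda>t::real. inner x y) has_vector_derivative inner x (app B y) + inner (app B x) y) (at 0)"
    by (simp add: inner_app exp_lie assms)
  moreover have "((\<lambda>t::real. inner x y) has_vector_derivative 0) (at 0)" by simp
  ultimately have "inner x (app B y) + inner (app B x) y = 0"
    by (rule vector_derivative_unique_at)
  then show ?thesis by linarith
qed

text \<open>Invariance under the adjoint action: conjugates of \<open>exp (t B)\<close> stay in
  \<open>K\<close>, and conjugation is continuous on difference quotients.\<close>

lemma lie_conjugate:
  assumes "B \<in> lie" "T \<in> K" "S \<in> K" "T * S = 1"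
  shows "T * B * S \<in> lie"
proof (rule lie_limit)
  let ?e = "\<lambda>n. 1 / real (Suc n)"
  show e: "?e \<longlonglongrightarrow> 0" by (rule lim_1_over_n[THEN LIMSEQ_Suc])
  show "T * exp (?e n *\<^sub>R B) * S \<in> K" for n by (intro mult assms exp_lie)
  have "(\<lambda>n. T * ((exp (?e n *\<^sub>R B) - 1) /\<^sub>R ?e n) * S) \<longlonglongrightarrow> T * B * S"
    by (intro tendsto_mult tendsto_const exp_scaleR_diff_quot_seq e) simp
  moreover have "(T * exp (?e n *\<^sub>R B) * S - 1) /\<^sub>R ?e n = T * ((exp (?e n *\<^sub>R B) - 1) /\<^sub>R ?e n) * S" for n
    using assms(4) by (simp add: algebra_simps)
  ultimately show "(\<lambda>n. (T * exp (?e n *\<^sub>R B) * S - 1) /\<^sub>R ?e n) \<longlonglongrightarrow> T * B * S" by simp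
qed simp

text \<open>With \<open>S\<close> inverse to \<open>T\<close>, the identity
  \<open>B T u = T (S B T) u\<close> shows that \<open>T\<close> carries the orbit tangent space at
  \<open>u\<close> over that at \<open>app T u\<close>.\<close>

lemma dim_lie_orbit_le:
  assumes "T \<in> K"
  shows "dim (lie_orbit (app T u)) \<le> dim (lie_orbit u)"
proof -
  obtain S where S: "S \<in> K" "S * T = 1" "T * S = 1" using ex_inverse[OF assms] .
  have "lie_orbit (app T u) \<subseteq> app T ` lie_orbit u"
  proof
    fix x assume "x \<in> lie_orbit (app T u)"
    then obtain B where B: "B \<in> lie" "x = app B (app T u)" by (auto simp: lie_orbit_def)
    have "x = app T (app (S * B * T) u)"
      using S(3) B(2) by (simp flip: app_mult mult.assoc)
    moreover have "app (S * B * T) u \<in> lie_orbit u"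
      unfolding lie_orbit_def by (intro imageI lie_conjugate B(1) S(1,2) assms)
    ultimately show "x \<in> app T ` lie_orbit u" by (metis imageI)
  qed
  then have "dim (lie_orbit (app T u)) \<le> dim (app T ` lie_orbit u)" by (rule dim_subset)
  also have "\<dots> \<le> dim (lie_orbit u)"
    using app.bounded_linear_right bounded_linear.linear dim_image_le by blast
  finally show ?thesis .
qed

text \<open>Take \<open>T\<close> maximising \<open>inner (app T y) u\<close>.\<close>

lemma meets_normal_space:
  obtains T where "T \<in> K" "\<And>B. B \<in> lie \<Longrightarrow> inner (app T y) (app B u) = 0"
proof -
  have "continuous_on K (\<lambda>T. inner (app T y) u)"
    by (intro continuous_intros bounded_bilinear.continuous_on[OF bounded_bilinear_app])
  then obtain T where T: "T \<in> K" "\<And>S. S \<in> K \<Longrightarrow> inner (app S y) u \<le> inner (app T y) u"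
    using continuous_attains_sup[OF compact] one by blast
  have "inner (app T y) (app B u) = 0" if B: "B \<in> lie" for B
  proof -
    have "((\<lambda>t. inner (app (exp (t *\<^sub>R B)) (app T y)) u) has_vector_derivative inner (app B (app T y)) u) (at 0)"
      using bounded_linear.has_vector_derivative[OF bounded_linear_inner_left app_lie_has_vector_derivative] .
    then have "((\<lambda>t. inner (app (exp (t *\<^sub>R B)) (app T y)) u) has_real_derivative inner (app B (app T y)) u) (at 0)"
      by (simp add: has_real_derivative_iff_has_vector_derivative)
    then have "inner (app B (app T y)) u = 0"
    proof (rule DERIV_local_max[where d=1])
      show "\<forall>t. \<bar>0 - t\<bar> < 1 \<longrightarrow> inner (app (exp (t *\<^sub>R B)) (app T y)) u \<le> inner (app (exp (0 *\<^sub>R B)) (app T y)) u"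
        using T(2)[OF mult[OF exp_lie[OF B] T(1)]] by simp
    qed simp
    then show ?thesis using lie_skew[OF B, of "app T y" u] by simp
  qed
  then show ?thesis using that T(1) by blast
qed

end

section \<open>Null sets and orthogonal projections\<close>

text \<open>\<open>R\<close> is the image of a subset of \<open>D\<close> under the inverse of
  \<open>c\<close>, which is Lipschitz at each point. As \<open>D\<close> may sit in a larger space
  than \<open>R\<close>, it is first moved isometrically to a proper subspace of the space of
  \<open>R\<close>.\<close>

lemma negligible_lipschitz_coded:
  fixes c :: "'s::euclidean_space \<Rightarrow> 'd::euclidean_space"
  assumes D: "subspace D" "dim D < DIM('s)" "c ` R \<subseteq> D"
    and lip: "\<And>p. p \<in> R \<Longrightarrow> \<exists>d>0. \<exists>B. \<forall>p'\<in>R. norm (c p' - c p) < d \<longrightarrow> norm (p' - p) \<le> B * norm (c p' - c p)"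
  shows "negligible R"
proof -
  obtain T :: "'s set" where T: "subspace T" "dim T = dim D"
    using choose_subspace_of_subspace[of "dim D" "UNIV :: 's set"] D(2) by auto
  obtain f g where f: "linear f" "f ` D = T" "\<And>x. x \<in> D \<Longrightarrow> norm (f x) = norm x"
    using isometries_subspaces[OF D(1) T(1)] T(2) by metis
  have iso: "norm (f (c p') - f (c p)) = norm (c p' - c p)" if "p \<in> R" "p' \<in> R" for p p'
    using f(3)[of "c p' - c p"] D that by (auto simp: linear_diff[OF f(1)] subspace_diff image_subset_iff)
  define h where "h = inv_into R (f \<circ> c)"
  have inj: "inj_on (f \<circ> c) R"
  proof (rule inj_onI)
    fix p p' assume p: "p \<in> R" "p' \<in> R" "(f \<circ> c) p = (f \<circ> c) p'"
    then have "norm (c p' - c p) = 0" using iso[OF p(1,2)] by simp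
    then have "norm (p' - p) \<le> 0" using lip[OF p(1)] p(2) by fastforce
    then show "p = p'" by simp
  qed
  have "negligible (h ` (f \<circ> c) ` R)"
  proof (rule negligible_locally_Lipschitz_image)
    have "(f \<circ> c) ` R \<subseteq> T" using D(3) f(2) by auto
    then have "dim ((f \<circ> c) ` R) < DIM('s)" using D(2) T(2) dim_subset le_less_trans by metis
    then show "negligible ((f \<circ> c) ` R)" by (rule negligible_lowdim)
    fix x assume "x \<in> (f \<circ> c) ` R"
    then obtain p where p: "p \<in> R" "x = f (c p)" by auto
    obtain d B where d: "d > 0" "\<And>p'. p' \<in> R \<Longrightarrow> norm (c p' - c p) < d \<Longrightarrow> norm (p' - p) \<le> B * norm (c p' - c p)"
      using lip[OF p(1)] by blast
    show "\<exists>T B. open T \<and> x \<in> T \<and> (\<forall>y\<in>(f \<circ> c) ` R \<inter> T. norm (h y - h x) \<le> B * norm (y - x))"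
    proof (intro exI conjI ballI)
      show "open (ball x d)" "x \<in> ball x d" using d(1) by auto
      fix y assume "y \<in> (f \<circ> c) ` R \<inter> ball x d"
      then obtain p' where p': "p' \<in> R" "y = f (c p')" "norm (y - x) < d"
        by (auto simp: dist_norm norm_minus_commute)
      have "h x = p" "h y = p'" unfolding h_def p(2) p'(2)
        using inv_into_f_f[OF inj p(1)] inv_into_f_f[OF inj p'(1)] by simp_all
      then show "norm (h y - h x) \<le> B * norm (y - x)"
        using d(2)[OF p'(1)] p'(3) iso[OF p(1) p'(1)] p(2) p'(2) by simp
    qed
  qed simp
  moreover have "h ` (f \<circ> c) ` R = R"
    unfolding h_def using inj by (metis image_inv_into_cancel inv_into_image_cancel order_refl)
  ultimately show ?thesis by simp
qed

lemma differentiable_imp_pointwise_Lipschitz: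
  assumes "f differentiable (at x)"
  obtains d B where "d > 0" "B \<ge> 0" "\<And>y. norm (y - x) < d \<Longrightarrow> norm (f y - f x) \<le> B * norm (y - x)"
proof -
  obtain f' where f': "(f has_derivative f') (at x)" using assms by (auto simp: differentiable_def)
  obtain B where B: "B > 0" "\<And>h. norm (f' h) \<le> norm h * B"
    using bounded_linear.pos_bounded[OF has_derivative_bounded_linear[OF f']] by blast
  obtain d where d: "d > 0" "\<And>y. norm (y - x) < d \<Longrightarrow> norm (f y - f x - f' (y - x)) \<le> 1 * norm (y - x)"
    using f' unfolding has_derivative_at_alt by (metis zero_less_one)
  have "norm (f y - f x) \<le> (B + 1) * norm (y - x)" if "norm (y - x) < d" for y
    using d(2)[OF that] B(2)[of "y - x"] norm_triangle_ineq[of "f y - f x - f' (y - x)" "f' (y - x)"]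
    by (simp add: algebra_simps)
  then show ?thesis using that[of d "B + 1"] d(1) B(1) by simp
qed

lemma subspace_projection:
  fixes S :: "'a::euclidean_space set"
  assumes "subspace S"
  obtains P where "linear P" "\<And>x. P x \<in> S" "\<And>x. x \<in> S \<Longrightarrow> P x = x"
    "\<And>x. norm (P x) \<le> norm x" "\<And>x y. y \<in> S \<Longrightarrow> inner (x - P x) y = 0"
proof -
  obtain B where B: "B \<subseteq> S" "pairwise orthogonal B" "\<And>x. x \<in> B \<Longrightarrow> norm x = 1"
    "independent B" "span B = S"
    using orthonormal_basis_subspace[OF assms] by metis
  define P where "P x = (\<Sum>b\<in>B. inner x b *\<^sub>R b)" for x
  have fin: "finite B" using B(4) independent_imp_finite by blast
  have lin: "linear P"
    by (rule linearI) (simp_all add: P_def inner_add_left scaleR_add_left sum.distrib scaleR_sum_right)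
  have PS: "P x \<in> S" for x
    unfolding P_def using B(1) assms by (intro subspace_sum subspace_scale) auto
  have Pb: "inner (P x) b = inner x b" if "b \<in> B" for x b
  proof -
    have "inner (P x) b = (\<Sum>c\<in>B. if c = b then inner x b else 0)"
      unfolding P_def inner_sum_left
    proof (rule sum.cong)
      fix c assume "c \<in> B"
      then show "inner (inner x c *\<^sub>R c) b = (if c = b then inner x b else 0)"
        using B(2) B(3)[OF that] that unfolding pairwise_def orthogonal_def
        by (auto simp: norm_eq_1)
    qed simp
    then show ?thesis using fin that by simp
  qed
  have orth: "inner (x - P x) y = 0" if "y \<in> S" for x y
  proof -
    have "y \<in> span B" using that B(5) by simp
    then show ?thesis
      by (induction rule: span_induct_alt) (simp_all add: Pb inner_add_right inner_diff_left)
  qed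
  have fixed: "P x = x" if "x \<in> S" for x
    using orth[of "x - P x" x] subspace_diff[OF assms that PS] by simp
  have "(norm (P x))\<^sup>2 \<le> (norm x)\<^sup>2" for x
  proof -
    have "(norm x)\<^sup>2 = (norm (x - P x))\<^sup>2 + (norm (P x))\<^sup>2 + 2 * inner (x - P x) (P x)"
      by (simp add: power2_norm_eq_inner algebra_simps inner_commute)
    then show ?thesis using orth[OF PS, of x x] by simp
  qed
  then have "norm (P x) \<le> norm x" for x using power2_le_imp_le norm_ge_zero by blast
  then show ?thesis using that lin PS fixed orth by blast
qed

section \<open>A chart of large dimension\<close>

text \<open>The one-sided part of a submanifold chart that the measure argument uses: coordinates in
  \<open>L\<close> and differentiability of the inverse at the coordinates of points of
  \<open>\<Sigma>\<close>.\<close>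

definition flattens where
  "flattens \<Sigma> U L \<phi> \<psi> \<longleftrightarrow> open U \<and> subspace L \<and> \<phi> ` (U \<inter> \<Sigma>) \<subseteq> L \<and>
     (\<forall>x\<in>U \<inter> \<Sigma>. \<psi> (\<phi> x) = x \<and> \<psi> differentiable (at (\<phi> x)))"

lemma norm_fst_proj_le: "norm (fst p) \<le> norm p"
  using norm_fst_le[of "fst p" "snd p"] by simp

lemma norm_snd_proj_le: "norm (snd p) \<le> norm p"
  using norm_snd_le[of "snd p" "fst p"] by simp

lemma norm_quadruple:
  "norm a \<le> norm (a, b, c, d)" "norm b \<le> norm (a, b, c, d)"
  "norm c \<le> norm (a, b, c, d)" "norm d \<le> norm (a, b, c, d)"
proof -
  show "norm a \<le> norm (a, b, c, d)" by (rule norm_fst_le)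
  have 1: "norm (b, c, d) \<le> norm (a, b, c, d)" by (rule norm_snd_le)
  have 2: "norm (c, d) \<le> norm (b, c, d)" by (rule norm_snd_le)
  show "norm b \<le> norm (a, b, c, d)" using norm_fst_le[of b "(c, d)"] 1 by linarith
  show "norm c \<le> norm (a, b, c, d)" using norm_fst_le[of c d] 1 2 by linarith
  show "norm d \<le> norm (a, b, c, d)" using norm_snd_le[of d c] 1 2 by linarith
qed

text \<open>A dimension count. If all charts were too small, the points over a neighbourhood of a
  regular \<open>u0\<close> would split into countably many pieces, each coded by fewer than
  \<open>DIM(('a, 'z) spt)\<close> parameters with a pointwise Lipschitz inverse.\<close>

lemma (in compact_isometry_group) ex_large_chart:
  fixes \<Sigma> :: "('a, 'z::euclidean_space) spt set" and \<pi> :: "'a \<Rightarrow> 'a"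
    and U :: "('a, 'z) spt \<Rightarrow> ('a, 'z) spt set" and \<phi> \<psi> :: "('a, 'z) spt \<Rightarrow> ('a, 'z) spt \<Rightarrow> ('a, 'z) spt"
  assumes w: "subspace w"
    and \<pi>: "linear \<pi>" "\<And>x. \<pi> x \<in> vperp w" "\<And>x. x \<in> vperp w \<Longrightarrow> \<pi> x = x" "\<And>x. x - \<pi> x \<in> w"
    and cover: "\<And>p :: ('a, 'z) spt. \<exists>T\<in>K. \<exists>q\<in>\<Sigma>. \<pi> (fst (fst p)) = app T (\<pi> (fst (fst q))) \<and> snd p = snd q"
    and charts: "\<And>q. q \<in> \<Sigma> \<Longrightarrow> q \<in> U q \<and> flattens \<Sigma> (U q) (L q) (\<phi> q) (\<psi> q)"
  shows "\<exists>q\<in>\<Sigma>. dim (L q) + dim (lie_orbit (\<pi> (fst (fst q)))) > dim (vperp w)"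
proof (rule ccontr)
  assume "\<not> ?thesis"
  then have small: "\<And>q. q \<in> \<Sigma> \<Longrightarrow> dim (L q) + dim (lie_orbit (\<pi> (fst (fst q)))) \<le> dim (vperp w)"
    by (meson not_le)
  have vperp: "subspace (vperp w)"
    unfolding vperp_def by (simp add: subspace_def inner_add_left)
  have "0 \<in> vperp w" using subspace_0[OF vperp] .
  have "\<exists>u0. u0 \<in> vperp w \<and> (\<forall>u. u \<in> vperp w \<longrightarrow> dim (lie_orbit u) \<le> dim (lie_orbit u0))"
    by (rule ex_has_greatest_nat[where k = 0 and b = "DIM('a) + 1"])
      (simp_all add: \<open>0 \<in> vperp w\<close> dim_subset_UNIV less_Suc_eq_le)
  then obtain u0 where u0: "u0 \<in> vperp w" "\<And>u. u \<in> vperp w \<Longrightarrow> dim (lie_orbit u) \<le> dim (lie_orbit u0)"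
    by blast
  define m where "m = dim (lie_orbit u0)"
  obtain P where P: "linear P" "\<And>x. P x \<in> lie_orbit u0" "\<And>x. x \<in> lie_orbit u0 \<Longrightarrow> P x = x" "\<And>x. norm (P x) \<le> norm x"
    using subspace_projection[OF subspace_lie_orbit] by metis
  obtain r d where r: "r > 0" and d: "d > 0" and graph: "\<And>u T. u \<in> vperp w \<Longrightarrow> norm (u - u0) < r \<Longrightarrow>
      T \<in> K \<Longrightarrow> norm (T - 1) < d \<Longrightarrow> norm (app T u - u) \<le> 5 * norm (P (app T u - u))"
    and regular: "\<And>u. u \<in> vperp w \<Longrightarrow> norm (u - u0) < r \<Longrightarrow> dim (lie_orbit u) = m"
    using orbit_graph[where A = "vperp w" and ?u0.0 = u0, OF u0(2) P(1,4,3)] unfolding m_def by metis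
  define pr where "pr p = \<pi> (fst (fst p))" for p :: "('a, 'z) spt"
  \<comment> \<open>A nonempty open tube, hence not negligible, over which all orbits have the
    maximal dimension \<open>m\<close>.\<close>
  define R where "R = {p. norm (pr p - u0) < r}"
  have "continuous_on UNIV pr"
    unfolding pr_def by (intro linear_continuous_on_compose[OF _ \<pi>(1)] continuous_intros)
  then have "open R"
    unfolding R_def by (intro open_Collect_less continuous_intros)
  moreover have "((u0, 0), 0) \<in> R" using \<pi>(3)[OF u0(1)] r by (simp add: R_def pr_def)
  ultimately have "\<not> negligible R" using open_not_negligible by blast
  define good where "good p T q \<longleftrightarrow> T \<in> K \<and> q \<in> \<Sigma> \<and> pr p = app T (pr q) \<and> snd p = snd q" for p T q
  have "\<exists>T q. good p T q" for p
    using cover[of p] unfolding good_def pr_def by blast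
  then obtain T q where "\<And>p. good p (T p) (q p)" by metis
  then have Tq: "\<And>p. T p \<in> K" "\<And>p. q p \<in> \<Sigma>" "\<And>p. pr p = app (T p) (pr (q p))" "\<And>p. snd p = snd (q p)"
    unfolding good_def by blast+
  have pr_w: "pr p \<in> vperp w" for p by (simp add: pr_def \<pi>(2))
  define \<Sigma>' where "\<Sigma>' = {q \<in> \<Sigma>. dim (lie_orbit (pr q)) = m}"
  \<comment> \<open>The dimension \<open>m\<close> at \<open>pr p\<close> is at most that at
    \<open>pr (q p)\<close>, because the group moves \<open>pr (q p)\<close> to \<open>pr p\<close>;
    maximality gives equality.\<close>
  have q': "q p \<in> \<Sigma>'" if "p \<in> R" for p
    using dim_lie_orbit_le[OF Tq(1)[of p], of "pr (q p)"] regular[OF pr_w[of p]] that u0(2)[OF pr_w[of "q p"]]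
      Tq(2)[of p] Tq(3)[of p, symmetric]
    by (simp add: \<Sigma>'_def R_def m_def)
  \<comment> \<open>Countably many charts suffice by Lindelof, and below finitely many balls of
    radius \<open>d / 2\<close> cover \<open>K\<close>; two group elements in the same ball differ
    by less than \<open>d\<close>.\<close>
  obtain \<F> where \<F>: "\<F> \<subseteq> U ` \<Sigma>'" "countable \<F>" "\<Union>\<F> = \<Union>(U ` \<Sigma>')"
    by (rule Lindelof[of "U ` \<Sigma>'"]) (use charts in \<open>auto simp: flattens_def \<Sigma>'_def\<close>)
  then obtain C where C: "countable C" "C \<subseteq> \<Sigma>'" "\<F> = U ` C" 
    using countable_subset_image[of \<F> U \<Sigma>'] by blast
  obtain F where F: "finite F" "F \<subseteq> K" "K \<subseteq> (\<Union>S\<in>F. ball S (d/2))"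
  proof (rule compactE_image[OF compact])
    show "K \<subseteq> (\<Union>S\<in>K. ball S (d/2))" using d by auto
  qed auto
  define piece where "piece z = {p \<in> R. T p \<in> ball (fst z) (d/2) \<and> q p \<in> U (snd z)}" for z
  have "R \<subseteq> (\<Union>z\<in>F \<times> C. piece z)"
  proof
    fix p assume p: "p \<in> R"
    obtain S where S: "S \<in> F" "T p \<in> ball S (d/2)" using F(3) Tq(1)[of p] by blast
    have "q p \<in> U (q p)" using charts[OF Tq(2)] by blast
    then have "q p \<in> \<Union>\<F>" using \<F>(3) q'[OF p] by blast
    then obtain c where "c \<in> C" "q p \<in> U c" using C(3) by blast
    then show "p \<in> (\<Union>z\<in>F \<times> C. piece z)" using S p by (force simp: piece_def)
  qed
  moreover have "negligible (piece z)" if z: "z \<in> F \<times> C" for z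
  proof -
    define c where "c = snd z"
    have c: "c \<in> \<Sigma>" "dim (lie_orbit (pr c)) = m" using z C(2) by (auto simp: c_def \<Sigma>'_def)
    have flat: "open (U c)" "subspace (L c)" "\<And>x. x \<in> U c \<inter> \<Sigma> \<Longrightarrow> \<phi> c x \<in> L c"
      "\<And>x. x \<in> U c \<inter> \<Sigma> \<Longrightarrow> \<psi> c (\<phi> c x) = x" "\<And>x. x \<in> U c \<inter> \<Sigma> \<Longrightarrow> \<psi> c differentiable (at (\<phi> c x))"
      using charts[OF c(1)] by (auto simp: flattens_def)
    have inU: "q p \<in> U c \<inter> \<Sigma>" if "p \<in> piece z" for p using that Tq(2) by (simp add: piece_def c_def)
    \<comment> \<open>Chart coordinates of the foot point \<open>q p\<close>, the component of
      \<open>pr p\<close> along the orbit of \<open>u0\<close>, the \<open>w\<close>-component and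
      the \<open>z\<close>-component. The last coordinate of \<open>p\<close> is that of
      \<open>q p\<close>, so the code has at most \<open>DIM('a) + DIM('z)\<close> parameters, one
      fewer than the space.\<close>
    define code where "code p = (\<phi> c (q p), P (pr p), fst (fst p) - pr p, snd (fst p))" for p
    define D where "D = L c \<times> lie_orbit u0 \<times> w \<times> (UNIV :: 'z set)"
    have dim_w: "dim (vperp w) + dim w = DIM('a)"
      using dim_subspace_orthogonal_to_vectors[OF w subspace_UNIV]
      by (simp add: vperp_def orthogonal_def inner_commute)
    show ?thesis
    proof (rule negligible_lipschitz_coded)
      show "subspace D"
        unfolding D_def by (intro subspace_Times flat(2) subspace_lie_orbit w subspace_UNIV)
      have "dim D = dim (L c) + (m + (dim w + DIM('z)))"
        unfolding D_def m_def using flat(2) w by (simp add: dim_Times subspace_Times subspace_lie_orbit)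
      then show "dim D < DIM(('a, 'z) spt)"
        using small[OF c(1)] c(2) dim_w by (simp add: pr_def)
      show "code ` piece z \<subseteq> D"
      proof (rule image_subsetI)
        fix p assume "p \<in> piece z"
        from flat(3)[OF inU[OF this]] show "code p \<in> D"
          using P(2) \<pi>(4) by (simp add: code_def D_def pr_def)
      qed
      fix p assume p: "p \<in> piece z"
      obtain e B where e: "e > 0" "B \<ge> 0"
        "\<And>y. norm (y - \<phi> c (q p)) < e \<Longrightarrow> norm (\<psi> c y - \<psi> c (\<phi> c (q p))) \<le> B * norm (y - \<phi> c (q p))"
        using differentiable_imp_pointwise_Lipschitz[OF flat(5)[OF inU[OF p]]] by blast
      have "norm (p' - p) \<le> (7 * B + 7) * norm (code p' - code p)"
        if p': "p' \<in> piece z" and near: "norm (code p' - code p) < e" for p'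
      proof -
        define h where "h = norm (code p' - code p)"
        have "code p' - code p = (\<phi> c (q p') - \<phi> c (q p), P (pr p') - P (pr p),
            (fst (fst p') - pr p') - (fst (fst p) - pr p), snd (fst p') - snd (fst p))"
          by (simp add: code_def)
        then have h: "norm (\<phi> c (q p') - \<phi> c (q p)) \<le> h" "norm (P (pr p') - P (pr p)) \<le> h"
            "norm ((fst (fst p') - pr p') - (fst (fst p) - pr p)) \<le> h" "norm (snd (fst p') - snd (fst p)) \<le> h"
          unfolding h_def by (simp_all only: norm_quadruple)
        have Bh: "norm (q p' - q p) \<le> B * h"
        proof -
          have "norm (\<psi> c (\<phi> c (q p')) - \<psi> c (\<phi> c (q p))) \<le> B * norm (\<phi> c (q p') - \<phi> c (q p))"
            using e(3) h(1) near by (simp add: h_def)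
          also have "\<dots> \<le> B * h" using h(1) e(2) by (rule mult_left_mono)
          finally show ?thesis using flat(4)[OF inU[OF p]] flat(4)[OF inU[OF p']] by simp
        qed
        \<comment> \<open>\<open>T p' * S\<close> is the group element near 1 that leads from the
          frame of \<open>p\<close> to that of \<open>p'\<close>.\<close>
        obtain S where S: "S \<in> K" "S * T p = 1" "T p * S = 1" using ex_inverse[OF Tq(1)] .
        have "T p' * S - 1 = (T p' - T p) * S" using S(3) by (simp add: algebra_simps)
        then have "norm (T p' * S - 1) \<le> norm (T p' - T p) * norm S" by (simp add: norm_mult_ineq)
        also have "\<dots> \<le> norm (T p' - T p) * 1" by (intro mult_left_mono norm_le_1 S) simp
        also have "\<dots> < d"
        proof -
          have "dist (fst z) (T p) < d / 2" "dist (fst z) (T p') < d / 2" using p p' by (auto simp: piece_def)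
          then have "dist (T p') (T p) < d"
            using dist_triangle[of "T p'" "T p" "fst z"] by (simp add: dist_commute)
          then show ?thesis by (simp add: dist_norm)
        qed
        finally have near1: "norm (T p' * S - 1) < d" .
        \<comment> \<open>The move from \<open>pr p\<close> to \<open>pr p'\<close> consists of a
          motion of the foot points, controlled by the chart, and the motion \<open>?y\<close> along
          the orbit of \<open>pr p\<close>, controlled through \<open>P\<close> by the graph
          estimate.\<close>
        let ?y = "app (T p' * S) (pr p) - pr p"
        have g: "norm ?y \<le> 5 * norm (P ?y)"
          using graph[OF pr_w _ mult[OF Tq(1) S(1)] near1] p by (simp add: piece_def R_def)
        have "app S (pr p) = pr (q p)" using Tq(3)[of p] S(2) by (metis app_mult app_one)
        then have "pr p' - pr p = app (T p') (pr (q p') - pr (q p)) + ?y"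
          using Tq(3)[of p'] by (simp add: app.diff_right)
        moreover have "norm (app (T p') (pr (q p') - pr (q p))) \<le> B * h"
        proof -
          have "norm (app (T p') (pr (q p') - pr (q p))) = norm (\<pi> (fst (fst (q p' - q p))))"
            by (simp add: isometry[OF Tq(1)] pr_def linear_diff[OF \<pi>(1)])
          also have "\<dots> \<le> norm (fst (fst (q p' - q p)))"
          proof -
            fix x
            have "norm x ^ 2 = norm (\<pi> x) ^ 2 + norm (x - \<pi> x) ^ 2"
              using \<pi>(2)[of x] \<pi>(4)[of x]
              by (auto simp: vperp_def power2_norm_eq_inner inner_diff_left inner_diff_right inner_commute)
            then have "norm (\<pi> x) ^ 2 \<le> norm x ^ 2" by simp
            then show "norm (\<pi> x) \<le> norm x" by (rule power2_le_imp_le) simp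
          qed
          also have "\<dots> \<le> norm (fst (q p' - q p))" by (rule norm_fst_proj_le)
          also have "\<dots> \<le> norm (q p' - q p)" by (rule norm_fst_proj_le)
          finally show ?thesis using Bh by linarith
        qed
        moreover have "norm (P ?y) \<le> h + B * h"
        proof -
          have "P ?y = (P (pr p') - P (pr p)) - P (app (T p') (pr (q p') - pr (q p)))"
            using calculation(1) by (simp flip: linear_diff[OF P(1)])
          then have "norm (P ?y) \<le> norm (P (pr p') - P (pr p)) + norm (P (app (T p') (pr (q p') - pr (q p))))"
            by (metis norm_triangle_ineq4)
          then show ?thesis
            using h(2) calculation(2) P(4)[of "app (T p') (pr (q p') - pr (q p))"] by linarith
        qed
        ultimately have u: "norm (pr p' - pr p) \<le> 6 * (B * h) + 5 * h"
          using g norm_triangle_ineq[of "app (T p') (pr (q p') - pr (q p))" ?y] by (simp only:)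
        have U: "norm (fst (fst p') - fst (fst p)) \<le> norm (pr p' - pr p) + h"
        proof -
          have "fst (fst p') - fst (fst p) = (pr p' - pr p) + ((fst (fst p') - pr p') - (fst (fst p) - pr p))" by simp
          then have "norm (fst (fst p') - fst (fst p)) \<le> norm (pr p' - pr p) + norm ((fst (fst p') - pr p') - (fst (fst p) - pr p))"
            by (metis norm_triangle_ineq)
          then show ?thesis using h(3) by linarith
        qed
        have a: "norm (snd p' - snd p) \<le> B * h"
          using norm_snd_proj_le[of "q p' - q p"] Bh Tq(4)[of p, symmetric] Tq(4)[of p', symmetric]
          by simp
        have "p' - p = ((fst (fst p') - fst (fst p), snd (fst p') - snd (fst p)), snd p' - snd p)"
          by (simp add: prod_eq_iff)
        then have "norm (p' - p) \<le> norm (fst (fst p') - fst (fst p)) + norm (snd (fst p') - snd (fst p)) + norm (snd p' - snd p)"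
          using norm_Pair_le[of "(fst (fst p') - fst (fst p), snd (fst p') - snd (fst p))" "snd p' - snd p"]
            norm_Pair_le[of "fst (fst p') - fst (fst p)" "snd (fst p') - snd (fst p)"] by (simp only:)
        also have "\<dots> \<le> 7 * (B * h) + 7 * h" using u U a h(4) by linarith
        also have "\<dots> \<le> (7 * B + 7) * h"
          by (simp add: algebra_simps)
        finally show ?thesis by (simp add: h_def)
      qed
      then show "\<exists>e>0. \<exists>B. \<forall>p'\<in>piece z. norm (code p' - code p) < e \<longrightarrow> norm (p' - p) \<le> B * norm (code p' - code p)"
        using e(1) by blast
    qed
  qed
  moreover have "countable (F \<times> C)" using F(1) C(1) by (simp add: countable_finite)
  then have "negligible (\<Union>(piece ` (F \<times> C)))"
    using calculation(2) by (intro negligible_countable_Union countable_image) auto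
  ultimately have "negligible R" using negligible_subset by blast
  then show False using \<open>\<not> negligible R\<close> by contradiction
qed

section \<open>Symmetry of second derivatives\<close>

declare dderiv.simps(2) [simp del]

lemma dderiv_has_vector_derivative:
  assumes "dderiv vs f differentiable (at x)"
  shows "((\<lambda>t. dderiv vs f (x + t *\<^sub>R v)) has_vector_derivative dderiv (v # vs) f x) (at 0)"
proof -
  have "((\<lambda>t. x + t *\<^sub>R v) has_derivative (\<lambda>t. t *\<^sub>R v)) (at 0)"
    by (auto intro!: derivative_eq_intros)
  then have "(\<lambda>t. x + t *\<^sub>R v) differentiable (at 0)" by (auto simp: differentiable_def)
  then have "(dderiv vs f \<circ> (\<lambda>t. x + t *\<^sub>R v)) differentiable (at 0)"
    using assms by (intro differentiable_chain_at) simp_all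
  then show ?thesis by (simp add: comp_def vector_derivative_works dderiv.simps(2))
qed

lemma dderiv_single_eq:
  assumes "(f has_derivative f') (at x)"
  shows "dderiv [v] f x = f' v"
proof -
  have "((\<lambda>t. x + t *\<^sub>R v) has_vector_derivative v) (at 0)"
    by (auto intro!: derivative_eq_intros simp: has_vector_derivative_def)
  then have "((f \<circ> (\<lambda>t. x + t *\<^sub>R v)) has_vector_derivative f' v) (at 0)"
    by (rule vector_derivative_diff_chain_within) (simp add: assms has_derivative_at_withinI)
  then show ?thesis by (simp add: comp_def vector_derivative_at dderiv.simps(2))
qed

lemma smooth_on_has_vector_derivative:
  assumes "smooth_on V f" "x \<in> V"
  shows "((\<lambda>t. dderiv vs f (x + t *\<^sub>R v)) has_vector_derivative dderiv (v # vs) f x) (at 0)"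
  using assms by (intro dderiv_has_vector_derivative) (auto simp: smooth_on_def)

text \<open>\<open>dderiv\<close> always differentiates at parameter 0; the shift supplies
  derivatives at every parameter, as the mean value theorem requires.\<close>

lemma has_real_derivative_along_line:
  fixes g :: "'a::real_vector \<Rightarrow> real"
  assumes "\<And>y. y \<in> S \<Longrightarrow> ((\<lambda>t. g (y + t *\<^sub>R v)) has_real_derivative g' y) (at 0)" "x + t *\<^sub>R v \<in> S"
  shows "((\<lambda>t. g (x + t *\<^sub>R v)) has_real_derivative g' (x + t *\<^sub>R v)) (at t)"
proof -
  have eq: "x + t *\<^sub>R v + s *\<^sub>R v = x + (s + t) *\<^sub>R v" for s
    by (simp add: scaleR_add_left)
  have "((\<lambda>s. g ((x + t *\<^sub>R v) + s *\<^sub>R v)) has_real_derivative g' (x + t *\<^sub>R v)) (at 0)"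
    by (rule assms(1)[OF assms(2)])
  then have "((\<lambda>s. g (x + (s + t) *\<^sub>R v)) has_real_derivative g' (x + t *\<^sub>R v)) (at 0)"
    by (simp only: eq)
  then show ?thesis using DERIV_shift[of "\<lambda>s. g (x + s *\<^sub>R v)" _ 0 t] by simp
qed

text \<open>The mean value theorem is applied in direction \<open>v\<close> to the difference of
  \<open>g\<close> along two parallel lines, then in direction \<open>u\<close> to
  \<open>gv\<close>.\<close>

lemma second_difference_mvt:
  fixes g :: "'a::real_normed_vector \<Rightarrow> real"
  assumes gv: "\<And>y. y \<in> ball x r \<Longrightarrow> ((\<lambda>t. g (y + t *\<^sub>R v)) has_real_derivative gv y) (at 0)"
    and guv: "\<And>y. y \<in> ball x r \<Longrightarrow> ((\<lambda>t. gv (y + t *\<^sub>R u)) has_real_derivative guv y) (at 0)"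
    and h: "h > 0" "h * (norm u + norm v) < r"
  shows "\<exists>y. norm (y - x) \<le> h * (norm u + norm v) \<and>
    g (x + h *\<^sub>R u + h *\<^sub>R v) - g (x + h *\<^sub>R u) - g (x + h *\<^sub>R v) + g x = h * (h * guv y)"
proof -
  have dist: "norm ((x + s *\<^sub>R u + t *\<^sub>R v) - x) \<le> h * (norm u + norm v)"
    if "0 \<le> s" "s \<le> h" "0 \<le> t" "t \<le> h" for s t
  proof -
    have "norm ((x + s *\<^sub>R u + t *\<^sub>R v) - x) \<le> norm (s *\<^sub>R u) + norm (t *\<^sub>R v)"
      using norm_triangle_ineq[of "s *\<^sub>R u" "t *\<^sub>R v"] by (simp add: algebra_simps)
    also have "\<dots> \<le> h * norm u + h * norm v"
      using that by (intro add_mono) (simp_all add: mult_right_mono)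
    finally show ?thesis by (simp add: algebra_simps)
  qed
  have in_ball: "x + s *\<^sub>R u + t *\<^sub>R v \<in> ball x r" if "0 \<le> s" "s \<le> h" "0 \<le> t" "t \<le> h" for s t
    using le_less_trans[OF dist[OF that] h(2)] by (simp only: mem_ball dist_norm norm_minus_commute[of x])
  have gv_along: "((\<lambda>t. g (z + t *\<^sub>R v)) has_real_derivative gv (z + t *\<^sub>R v)) (at t)"
    if "z + t *\<^sub>R v \<in> ball x r" for z t
    by (rule has_real_derivative_along_line[where S = "ball x r", OF gv that])
  have guv_along: "((\<lambda>t. gv (z + t *\<^sub>R u)) has_real_derivative guv (z + t *\<^sub>R u)) (at t)"
    if "z + t *\<^sub>R u \<in> ball x r" for z t
    by (rule has_real_derivative_along_line[where S = "ball x r", OF guv that])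
  have "((\<lambda>t. g (x + h *\<^sub>R u + t *\<^sub>R v) - g (x + t *\<^sub>R v)) has_real_derivative
      gv (x + h *\<^sub>R u + t *\<^sub>R v) - gv (x + t *\<^sub>R v)) (at t)" if "0 \<le> t" "t \<le> h" for t
    using in_ball[of h t] in_ball[of 0 t] that h(1) by (intro DERIV_diff gv_along) simp_all
  from MVT2[OF h(1) this]
  obtain t where t: "0 < t" "t < h" "g (x + h *\<^sub>R u + h *\<^sub>R v) - g (x + h *\<^sub>R u) - g (x + h *\<^sub>R v) + g x
      = h * (gv (x + h *\<^sub>R u + t *\<^sub>R v) - gv (x + t *\<^sub>R v))"
    by auto
  have swap: "x + t *\<^sub>R v + s *\<^sub>R u = x + s *\<^sub>R u + t *\<^sub>R v" for s by simp
  have "((\<lambda>s. gv (x + t *\<^sub>R v + s *\<^sub>R u)) has_real_derivative guv (x + t *\<^sub>R v + s *\<^sub>R u)) (at s)"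
    if "0 \<le> s" "s \<le> h" for s
    using in_ball[of s t] that t by (intro guv_along) (simp only: swap)
  from MVT2[OF h(1) this]
  obtain s where s: "0 < s" "s < h" "gv (x + h *\<^sub>R u + t *\<^sub>R v) - gv (x + t *\<^sub>R v) = h * guv (x + s *\<^sub>R u + t *\<^sub>R v)"
    unfolding swap by auto
  show ?thesis
  proof (intro exI conjI)
    show "norm ((x + s *\<^sub>R u + t *\<^sub>R v) - x) \<le> h * (norm u + norm v)"
      using s t by (intro dist) auto
    show "g (x + h *\<^sub>R u + h *\<^sub>R v) - g (x + h *\<^sub>R u) - g (x + h *\<^sub>R v) + g x = h * (h * guv (x + s *\<^sub>R u + t *\<^sub>R v))"
      unfolding t(3) s(3) ..
  qed
qed

text \<open>Schwarz's theorem, tested against each \<open>c\<close>: the second difference is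
  symmetric in \<open>u\<close> and \<open>v\<close>, and by continuity either mixed derivative is
  the limit of its quotient by the square of the step.\<close>

lemma dderiv_commute:
  fixes f :: "'a::real_normed_vector \<Rightarrow> 'b::real_inner"
  assumes V: "open V" "x \<in> V" and f: "smooth_on V f"
  shows "dderiv [u, v] f x = dderiv [v, u] f x"
proof (rule vector_eq_rdot[THEN iffD1], rule allI)
  fix c
  obtain r where r: "r > 0" "ball x r \<subseteq> V" using V open_contains_ball by blast
  have D: "((\<lambda>t. inner (dderiv vs f (y + t *\<^sub>R w)) c) has_real_derivative inner (dderiv (w # vs) f y) c) (at 0)"
    if "y \<in> ball x r" for y vs w
    unfolding has_real_derivative_iff_has_vector_derivative
    using that r by (intro bounded_linear.has_vector_derivative[OF bounded_linear_inner_left]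
        smooth_on_has_vector_derivative[OF f]) auto
  define N where "N = norm u + norm v"
  \<comment> \<open>The denominator \<open>Suc (Suc n)\<close> is at least 2, which makes
    \<open>h n * N < r\<close> strict already for \<open>n = 0\<close>; adding 1 to \<open>N\<close>
    covers the case of two zero directions.\<close>
  define h where "h n = r / (N + 1) * (1 / real (Suc (Suc n)))" for n
  have N: "N \<ge> 0" by (simp add: N_def)
  have h: "h n > 0" "h n * N < r" for n
  proof -
    show "h n > 0" using r N by (simp add: h_def)
    have "h n * N \<le> h n * (N + 1)" using \<open>h n > 0\<close> by simp
    also have "\<dots> = r * (1 / real (Suc (Suc n)))" using N by (simp add: h_def)
    also have "\<dots> < r * 1" using r(1) by (intro mult_strict_left_mono) simp_all
    finally show "h n * N < r" by simp
  qed
  have "h \<longlonglongrightarrow> r / (N + 1) * 0"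
    unfolding h_def by (intro tendsto_mult tendsto_const lim_1_over_n[THEN LIMSEQ_Suc, THEN LIMSEQ_Suc])
  from tendsto_mult[OF this tendsto_const[of N]] have hN: "(\<lambda>n. h n * N) \<longlonglongrightarrow> 0" by simp
  define d where "d n = inner (f (x + h n *\<^sub>R u + h n *\<^sub>R v)) c - inner (f (x + h n *\<^sub>R u)) c
      - inner (f (x + h n *\<^sub>R v)) c + inner (f x) c" for n
  have D0: "((\<lambda>t. inner (f (y + t *\<^sub>R w)) c) has_real_derivative inner (dderiv [w] f y) c) (at 0)"
    if "y \<in> ball x r" for y w
    using D[OF that, of "[]" w] by simp
  have "\<exists>y. norm (y - x) \<le> h n * N \<and> d n = h n * (h n * inner (dderiv [u, v] f y) c)" for n
    using second_difference_mvt[OF D0 D[of _ "[v]" u] h(1) h(2)[unfolded N_def]]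
    unfolding d_def N_def .
  then obtain y where y: "\<And>n. norm (y n - x) \<le> h n * N"
      "\<And>n. d n = h n * (h n * inner (dderiv [u, v] f (y n)) c)" by metis
  have "h n * (norm v + norm u) < r" for n using h(2)[of n] by (simp add: N_def add.commute)
  from second_difference_mvt[OF D0 D[of _ "[u]" v] h(1) this]
  have "\<exists>y. norm (y - x) \<le> h n * N \<and> inner (f (x + h n *\<^sub>R v + h n *\<^sub>R u)) c - inner (f (x + h n *\<^sub>R v)) c
      - inner (f (x + h n *\<^sub>R u)) c + inner (f x) c = h n * (h n * inner (dderiv [v, u] f y) c)" for n
    unfolding N_def add.commute[of "norm u"] .
  moreover have "x + h n *\<^sub>R v + h n *\<^sub>R u = x + h n *\<^sub>R u + h n *\<^sub>R v" for n by simp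
  moreover have "inner (f (x + h n *\<^sub>R u + h n *\<^sub>R v)) c - inner (f (x + h n *\<^sub>R v)) c
      - inner (f (x + h n *\<^sub>R u)) c + inner (f x) c = d n" for n by (simp add: d_def)
  ultimately have "\<exists>y. norm (y - x) \<le> h n * N \<and> d n = h n * (h n * inner (dderiv [v, u] f y) c)" for n
    by (simp only:)
  then obtain z where z: "\<And>n. norm (z n - x) \<le> h n * N"
      "\<And>n. d n = h n * (h n * inner (dderiv [v, u] f (z n)) c)" by metis
  have eq: "inner (dderiv [u, v] f (y n)) c = inner (dderiv [v, u] f (z n)) c" for n
    using y(2)[of n] z(2)[of n] h(1)[of n] by simp
  have lim: "(\<lambda>n. inner (dderiv vs f (a n)) c) \<longlonglongrightarrow> inner (dderiv vs f x) c"
    if "\<And>n. norm (a n - x) \<le> h n * N" for a vs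
  proof -
    have "(\<lambda>n. a n - x) \<longlonglongrightarrow> 0"
      by (rule Lim_null_comparison[OF always_eventually[OF allI[OF that]] hN])
    then have a: "a \<longlonglongrightarrow> x" by (rule Lim_null[THEN iffD2])
    have "isCont (dderiv vs f) x"
      using f V(2) differentiable_imp_continuous_within unfolding smooth_on_def by blast
    from tendsto_inner[OF isCont_tendsto_compose[OF this a] tendsto_const] show ?thesis .
  qed
  show "inner (dderiv [u, v] f x) c = inner (dderiv [v, u] f x) c"
    by (rule LIMSEQ_unique[OF lim[OF y(1)]]) (simp only: eq lim[OF z(1)])
qed

text \<open>Differentiating \<open>eq\<close> once more, the second derivatives of \<open>\<psi>\<close> cancel by symmetry.\<close>

lemma second_order_symmetry:
  fixes \<psi> :: "'a::real_normed_vector \<Rightarrow> 'b::real_inner"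
  assumes V: "open V" and \<psi>: "smooth_on V \<psi>" and L: "subspace L"
    and lin: "bounded_linear M" "bounded_linear N" and \<beta>: "bounded_bilinear \<beta>"
    and eq: "\<And>y \<eta>. y \<in> V \<Longrightarrow> y \<in> L \<Longrightarrow> \<eta> \<in> L \<Longrightarrow> M (dderiv [\<eta>] \<psi> y) = \<beta> (N (\<psi> y)) (N (dderiv [\<eta>] \<psi> y))"
    and x: "x \<in> V" "x \<in> L" and \<zeta>: "\<zeta> \<in> L" and \<eta>: "\<eta> \<in> L"
  shows "\<beta> (N (dderiv [\<zeta>] \<psi> x)) (N (dderiv [\<eta>] \<psi> x)) = \<beta> (N (dderiv [\<eta>] \<psi> x)) (N (dderiv [\<zeta>] \<psi> x))"
proof -
  have key: "M (dderiv [\<zeta>, \<eta>] \<psi> x) = \<beta> (N (\<psi> x)) (N (dderiv [\<zeta>, \<eta>] \<psi> x)) + \<beta> (N (dderiv [\<zeta>] \<psi> x)) (N (dderiv [\<eta>] \<psi> x))"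
    if \<zeta>: "\<zeta> \<in> L" and \<eta>: "\<eta> \<in> L" for \<zeta> \<eta>
  proof -
    have 0: "((\<lambda>t. \<psi> (x + t *\<^sub>R \<zeta>)) has_vector_derivative dderiv [\<zeta>] \<psi> x) (at 0)"
      using smooth_on_has_vector_derivative[OF \<psi> x(1), of "[]"] by simp
    have 1: "((\<lambda>t. dderiv [\<eta>] \<psi> (x + t *\<^sub>R \<zeta>)) has_vector_derivative dderiv [\<zeta>, \<eta>] \<psi> x) (at 0)"
      by (rule smooth_on_has_vector_derivative[OF \<psi> x(1)])
    have "((\<lambda>t. \<beta> (N (\<psi> (x + t *\<^sub>R \<zeta>))) (N (dderiv [\<eta>] \<psi> (x + t *\<^sub>R \<zeta>)))) has_vector_derivative
        \<beta> (N (\<psi> (x + 0 *\<^sub>R \<zeta>))) (N (dderiv [\<zeta>, \<eta>] \<psi> x)) + \<beta> (N (dderiv [\<zeta>] \<psi> x)) (N (dderiv [\<eta>] \<psi> (x + 0 *\<^sub>R \<zeta>)))) (at 0)"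
      by (intro bounded_bilinear.has_vector_derivative[OF \<beta>] bounded_linear.has_vector_derivative[OF lin(2)] 0 1)
    \<comment> \<open>\<open>eq\<close> holds along the line for small \<open>t\<close>: the points
      stay in the open set \<open>V\<close>, and in \<open>L\<close> because \<open>\<zeta>\<close>
      does.\<close>
    then have "((\<lambda>t. M (dderiv [\<eta>] \<psi> (x + t *\<^sub>R \<zeta>))) has_vector_derivative
        \<beta> (N (\<psi> (x + 0 *\<^sub>R \<zeta>))) (N (dderiv [\<zeta>, \<eta>] \<psi> x)) + \<beta> (N (dderiv [\<zeta>] \<psi> x)) (N (dderiv [\<eta>] \<psi> (x + 0 *\<^sub>R \<zeta>)))) (at 0)"
    proof (rule has_vector_derivative_transform_within_open)
      show "open ((\<lambda>t. x + t *\<^sub>R \<zeta>) -` V)" by (intro open_vimage V continuous_intros)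
    qed (use eq \<eta> \<zeta> x L in \<open>simp_all add: subspace_add subspace_scale\<close>)
    from vector_derivative_unique_at[OF this bounded_linear.has_vector_derivative[OF lin(1) 1]]
    show ?thesis by simp
  qed
  show ?thesis
    using key[OF \<zeta> \<eta>] key[OF \<eta> \<zeta>] dderiv_commute[OF V x(1) \<psi>, of \<zeta> \<eta>] by simp
qed

section \<open>Tangent vectors and charts\<close>

lemma tangent_vecsI:
  assumes "(\<gamma> has_vector_derivative D) (at 0)" "\<gamma> 0 = p" "\<And>t. \<gamma> t \<in> M"
  shows "D \<in> tangent_vecs M p"
  unfolding tangent_vecs_def
  using assms vector_derivative_at[OF assms(1)] differentiableI_vector[OF assms(1)] by blast

lemma tangent_vecsE:
  assumes "D \<in> tangent_vecs M p"
  obtains \<gamma> where "(\<gamma> has_vector_derivative D) (at 0)" "\<gamma> 0 = p" "\<And>t. \<gamma> t \<in> M"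
  using assms unfolding tangent_vecs_def by (auto simp: vector_derivative_works)

lemma tangent_vecs_subspace:
  fixes L :: "'a::euclidean_space set"
  assumes "subspace L" "D \<in> tangent_vecs L p"
  shows "D \<in> L"
proof -
  obtain \<gamma> where \<gamma>: "(\<gamma> has_vector_derivative D) (at 0)" "\<And>t. \<gamma> t \<in> L"
    using tangent_vecsE[OF assms(2)] by blast
  have "(\<lambda>n. (\<gamma> (1 / real (Suc n)) - \<gamma> 0) /\<^sub>R (1 / real (Suc n))) \<longlonglongrightarrow> D"
    by (rule vector_derivative_diff_quot_seq[OF \<gamma>(1) lim_1_over_n[THEN LIMSEQ_Suc]]) simp
  then show ?thesis
    by (rule closed_sequentially[OF closed_subspace[OF assms(1)], rotated])
      (intro subspace_scale subspace_diff \<gamma>(2) assms(1))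
qed

text \<open>Restates a chart through the parametrization \<open>\<psi>\<close>, along which all
  later identities are differentiated. It is immersive because \<open>\<phi>\<close> inverts
  it.\<close>

lemma embedded_submanifold_chart:
  fixes \<Sigma> :: "'a::euclidean_space set"
  assumes "embedded_submanifold \<Sigma>" "q \<in> \<Sigma>"
  obtains U V and \<phi> \<psi> :: "'a \<Rightarrow> 'a" and L where "q \<in> U" "flattens \<Sigma> U L \<phi> \<psi>" "open V" "smooth_on V \<psi>" "\<phi> q \<in> V"
    "\<And>y. y \<in> V \<Longrightarrow> linear (\<lambda>\<eta>. dderiv [\<eta>] \<psi> y)"
    "\<And>y \<eta>. y \<in> V \<Longrightarrow> dderiv [\<eta>] \<psi> y = 0 \<Longrightarrow> \<eta> = 0"
    "\<And>y. y \<in> V \<Longrightarrow> y \<in> L \<Longrightarrow> \<psi> y \<in> \<Sigma>"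
    "\<And>y \<eta>. y \<in> V \<Longrightarrow> y \<in> L \<Longrightarrow> \<eta> \<in> L \<Longrightarrow> dderiv [\<eta>] \<psi> y \<in> tangent_vecs \<Sigma> (\<psi> y)"
proof -
  obtain U V and \<phi> :: "'a \<Rightarrow> 'a" and \<psi> L where c: "open U" "q \<in> U" "open V" "\<phi> ` U = V" "smooth_on U \<phi>" "smooth_on V \<psi>"
     "\<And>x. x \<in> U \<Longrightarrow> \<psi> (\<phi> x) = x" "\<And>y. y \<in> V \<Longrightarrow> \<phi> (\<psi> y) = y" "subspace L" "\<phi> ` (U \<inter> \<Sigma>) = V \<inter> L"
    using assms unfolding embedded_submanifold_def by metis
  have diff: "\<psi> differentiable (at y)" if "y \<in> V" for y
    using c(6) that unfolding smooth_on_def by (metis dderiv.simps(1))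
  have diff': "\<phi> differentiable (at x)" if "x \<in> U" for x
    using c(5) that unfolding smooth_on_def by (metis dderiv.simps(1))
  have \<psi>U: "\<psi> y \<in> U" if "y \<in> V" for y using that c(4,7) by auto
  have on: "\<psi> y \<in> \<Sigma>" if "y \<in> V" "y \<in> L" for y
  proof -
    have "y \<in> \<phi> ` (U \<inter> \<Sigma>)" using that c(10) by blast
    then show ?thesis using c(7) by auto
  qed
  show ?thesis
  proof (rule that[of U L \<phi> \<psi> V])
    show "flattens \<Sigma> U L \<phi> \<psi>"
      unfolding flattens_def using c diff by blast
    show "\<phi> q \<in> V" using c by auto
    show "linear (\<lambda>\<eta>. dderiv [\<eta>] \<psi> y)" if y: "y \<in> V" for y
    proof -
      obtain f' where f': "(\<psi> has_derivative f') (at y)" using diff[OF y] by (auto simp: differentiable_def)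
      show ?thesis
        unfolding dderiv_single_eq[OF f'] using has_derivative_linear[OF f'] by simp
    qed
    show "\<eta> = 0" if y: "y \<in> V" and 0: "dderiv [\<eta>] \<psi> y = 0" for y \<eta>
    proof -
      obtain f' where f': "(\<psi> has_derivative f') (at y)" using diff[OF y] by (auto simp: differentiable_def)
      obtain g' where g': "(\<phi> has_derivative g') (at (\<psi> y))" using diff'[OF \<psi>U[OF y]] by (auto simp: differentiable_def)
      have "(\<phi> \<circ> \<psi> has_derivative g' \<circ> f') (at y)" by (rule diff_chain_at[OF f' g'])
      then have "((\<lambda>y. y) has_derivative g' \<circ> f') (at y)"
        by (rule has_derivative_transform_within_open[OF _ c(3) y]) (simp add: c(8))
      then have "g' \<circ> f' = (\<lambda>y. y)" using has_derivative_unique has_derivative_ident by blast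
      moreover have "f' \<eta> = 0" using 0 by (simp add: dderiv_single_eq[OF f'])
      ultimately show ?thesis using linear_0[OF has_derivative_linear[OF g']] by (metis comp_apply)
    qed
    show "dderiv [\<eta>] \<psi> y \<in> tangent_vecs \<Sigma> (\<psi> y)" if y: "y \<in> V" "y \<in> L" and \<eta>: "\<eta> \<in> L" for y \<eta>
    proof (rule tangent_vecsI)
      have "((\<lambda>t. \<psi> (y + t *\<^sub>R \<eta>)) has_vector_derivative dderiv [\<eta>] \<psi> y) (at 0)"
        using smooth_on_has_vector_derivative[OF c(6) y(1), of "[]"] by simp
      \<comment> \<open>A curve for \<open>tangent_vecs\<close> must stay in \<open>\<Sigma>\<close>
        for all times, so it is replaced by the constant \<open>\<psi> y\<close> where the line has
        left \<open>V\<close>.\<close>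
      then show "((\<lambda>t. if y + t *\<^sub>R \<eta> \<in> V then \<psi> (y + t *\<^sub>R \<eta>) else \<psi> y) has_vector_derivative dderiv [\<eta>] \<psi> y) (at 0)"
      proof (rule has_vector_derivative_transform_within_open)
        show "open ((\<lambda>t. y + t *\<^sub>R \<eta>) -` V)" by (intro open_vimage c(3) continuous_intros)
      qed (use y(1) in simp_all)
      show "(if y + t *\<^sub>R \<eta> \<in> V then \<psi> (y + t *\<^sub>R \<eta>) else \<psi> y) \<in> \<Sigma>" for t
        using on y \<eta> c(9) by (simp add: subspace_add subspace_scale)
    qed (use y(1) in simp)
  qed (use c on in auto)
qed

text \<open>The identity is a global chart; its iterated derivatives are the identity or
  constants.\<close>

lemma embedded_submanifold_subspace:
  fixes L :: "'a::euclidean_space set"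
  assumes "subspace L"
  shows "embedded_submanifold L"
proof -
  have "dderiv vs (\<lambda>x::'a. x) = (\<lambda>x. x) \<or> (\<exists>c. dderiv vs (\<lambda>x::'a. x) = (\<lambda>_. c))" for vs
  proof (induction vs)
    case (Cons v vs)
    have "dderiv [v] (\<lambda>x. x) = (\<lambda>_::'a. v)"
      using dderiv_single_eq[OF has_derivative_ident] by auto
    then have "dderiv (v # vs) (\<lambda>x::'a. x) = (\<lambda>_. v)" if "dderiv vs (\<lambda>x::'a. x) = (\<lambda>x. x)"
      using that by (simp add: dderiv.simps(2))
    with Cons show ?case by (auto simp: dderiv.simps(2))
  qed simp
  then have "dderiv vs (\<lambda>x::'a. x) differentiable (at x)" for vs x
    by (metis differentiable_const differentiable_ident)
  then have "smooth_on UNIV (\<lambda>x::'a. x)" by (simp add: smooth_on_def)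
  then show ?thesis
    unfolding embedded_submanifold_def using assms
    by (intro ballI exI[of _ UNIV] exI[of _ "\<lambda>x. x"] exI[of _ L]) simp
qed

section \<open>The left-invariant metric in coordinates\<close>

lemma smult_sinv:
  assumes "bounded_bilinear br"
  shows "smult br (sinv ((U, X), a)) P = ((exp (- a / 2) *\<^sub>R (fst (fst P) - U),
      exp (- a) *\<^sub>R (snd (fst P) - X) - (exp (- a) / 2) *\<^sub>R br U (fst (fst P))), snd P - a)"
proof -
  have "exp (- a / 2) * exp (- a / 2) = exp (- a)" by (simp flip: exp_add)
  then show ?thesis
    by (simp add: smult_def sinv_def Let_def bounded_bilinear.minus_left[OF assms]
        bounded_bilinear.scaleR_left[OF assms] bounded_bilinear.scaleR_right[OF assms] algebra_simps)
qed

text \<open>Left translation by the inverse is affine in these coordinates, so its derivative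
  \<open>F\<close> is the linear part. The left-invariant \<open>z\<close>-component is
  \<open>dX - (1/2) [U, dU]\<close>, scaled by \<open>exp (- a)\<close>, while \<open>v\<close> is
  scaled by \<open>exp (- a / 2)\<close>.\<close>

lemma smetric_eq:
  assumes "bounded_bilinear br"
  shows "smetric br ((U, X), a) \<xi> \<eta> = exp (- a) * inner (fst (fst \<xi>)) (fst (fst \<eta>))
    + exp (- a) * exp (- a) * inner (snd (fst \<xi>) - (1/2) *\<^sub>R br U (fst (fst \<xi>))) (snd (fst \<eta>) - (1/2) *\<^sub>R br U (fst (fst \<eta>)))
    + snd \<xi> * snd \<eta>"
proof -
  define F where "F = (\<lambda>\<xi> :: ('a, 'b) spt. ((exp (- a / 2) *\<^sub>R fst (fst \<xi>),
      exp (- a) *\<^sub>R (snd (fst \<xi>) - (1/2) *\<^sub>R br U (fst (fst \<xi>)))), snd \<xi>))"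
  have blin: "bounded_linear (br U)" by (rule bounded_bilinear.bounded_linear_right[OF assms])
  have "(smult br (sinv ((U, X), a)) has_derivative F) (at ((U, X), a))"
    unfolding smult_sinv[OF assms, abs_def] F_def
    by (auto intro!: derivative_eq_intros bounded_linear.has_derivative[OF blin] simp: algebra_simps)
  then have F: "frechet_derivative (smult br (sinv ((U, X), a))) (at ((U, X), a)) = F"
    by (rule frechet_derivative_at[symmetric])
  have "exp (- a / 2) * exp (- a / 2) = exp (- a)" by (simp flip: exp_add)
  then show ?thesis
    unfolding smetric_def F by (simp add: F_def inner_Pair mult.assoc[symmetric])
qed

section \<open>The action on a Damek--Ricci space\<close>

locale damek_ricci_action =
  fixes br :: "'v::euclidean_space \<Rightarrow> 'v \<Rightarrow> 'z::euclidean_space"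
    and J :: "'z \<Rightarrow> 'v \<Rightarrow> 'v"
    and w :: "'v set"
    and Q :: "(('v \<times> 'z) \<Rightarrow>\<^sub>L ('v \<times> 'z)) set"
  assumes br_bilinear: "bounded_bilinear br"
    and br_skew: "\<And>U V. br U V = - br V U"
    and J_def: "\<And>Z U V. inner (J Z U) V = inner (br U V) Z"
    and J_sq: "\<And>Z U. J Z (J Z U) = - (inner Z Z) *\<^sub>R U"
    and w_sub: "subspace w"
    and Q_closed: "closed Q"
    and Q_sub: "Q \<subseteq> AN0 br"
    and Q_id: "id_blinfun \<in> Q"
    and Q_comp: "\<And>\<sigma> \<tau>. \<sigma> \<in> Q \<Longrightarrow> \<tau> \<in> Q \<Longrightarrow> \<sigma> o\<^sub>L \<tau> \<in> Q"
    and Q_inv: "\<And>\<sigma>. \<sigma> \<in> Q \<Longrightarrow> \<exists>\<tau>\<in>Q. \<tau> o\<^sub>L \<sigma> = id_blinfun"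
    and Q_w: "\<And>\<sigma> u. \<sigma> \<in> Q \<Longrightarrow> u \<in> w \<Longrightarrow> vact \<sigma> u \<in> w"
begin

section \<open>Elements of \<open>Q\<close> respect the splitting into \<open>v\<close> and
  \<open>z\<close>\<close>

interpretation br: bounded_bilinear br by (rule br_bilinear)

lemma Q_AN: "\<sigma> \<in> Q \<Longrightarrow> \<sigma> \<in> AN br"
  using Q_sub connected_component_subset unfolding AN0_def by blast

lemma norm_Q: "\<sigma> \<in> Q \<Longrightarrow> norm (blinfun_apply \<sigma> Y) = norm Y"
  using Q_AN unfolding AN_def by blast

lemma inner_Q:
  assumes "\<sigma> \<in> Q"
  shows "inner (blinfun_apply \<sigma> Y) (blinfun_apply \<sigma> Y') = inner Y Y'"
  using norm_Q[OF assms, of "Y + Y'"] norm_Q[OF assms, of Y] norm_Q[OF assms, of Y']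
  by (simp add: blinfun.add_right norm_eq_sqrt_inner inner_add_left inner_add_right inner_commute)

text \<open>A vector \<open>Z\<close> orthogonal to all brackets has \<open>J Z = 0\<close>; as
  \<open>v\<close> contains a nonzero vector, \<open>J_sq\<close> forces
  \<open>Z = 0\<close>.\<close>

lemma span_br: "span (range (\<lambda>p. br (fst p) (snd p))) = UNIV"
proof (rule ccontr)
  assume "\<not> ?thesis"
  then have "dim (range (\<lambda>p. br (fst p) (snd p))) < DIM('z)"
    using dim_eq_full[of "range (\<lambda>p. br (fst p) (snd p))"] dim_subset_UNIV[of "range (\<lambda>p. br (fst p) (snd p))"]
    by linarith
  then obtain Z where Z: "Z \<noteq> 0" "\<And>x. x \<in> span (range (\<lambda>p. br (fst p) (snd p))) \<Longrightarrow> orthogonal Z x"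
    using orthogonal_to_subspace_exists by blast
  have "inner (br U V) Z = 0" for U V
    using Z(2)[OF span_base[OF rangeI[of "\<lambda>p. br (fst p) (snd p)" "(U, V)"]]]
    by (simp add: orthogonal_def inner_commute)
  then have J0: "J Z U = 0" for U using J_def[of Z U "J Z U"] by simp
  obtain U :: 'v where "norm U = 1" using vector_choose_size[of 1] by auto
  then have "U \<noteq> 0" by auto
  then show False using J_sq[of Z U] Z(1) by (simp add: J0)
qed

text \<open>An automorphism preserves the derived algebra, which is all of \<open>z\<close> by
  \<open>span_br\<close>.\<close>

lemma Q_center:
  assumes \<sigma>: "\<sigma> \<in> Q"
  shows "fst (blinfun_apply \<sigma> (0, X)) = 0"
proof -
  have lin: "linear (\<lambda>X. fst (blinfun_apply \<sigma> (0, X)))"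
    by (rule bounded_linear.linear[OF bounded_linear_compose[OF bounded_linear_fst
          bounded_linear_compose[OF blinfun.bounded_linear_right
            bounded_linear_Pair[OF bounded_linear_zero bounded_linear_ident]]]])
  have "fst (blinfun_apply \<sigma> (0, br U V)) = 0" for U V
  proof -
    have "blinfun_apply \<sigma> (nbr br (U, 0) (V, 0)) = nbr br (blinfun_apply \<sigma> (U, 0)) (blinfun_apply \<sigma> (V, 0))"
      using Q_AN[OF \<sigma>] unfolding AN_def by blast
    then show ?thesis by (simp add: nbr_def)
  qed
  note br0 = this
  have "fst (blinfun_apply \<sigma> (0, X)) = 0" if "X \<in> span (range (\<lambda>p. br (fst p) (snd p)))"
    by (rule linear_eq_0_on_span[OF lin _ that]) (auto simp: br0)
  then show ?thesis using span_br by simp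
qed

lemma Q_center_surj:
  assumes \<sigma>: "\<sigma> \<in> Q"
  obtains Y where "blinfun_apply \<sigma> (0, Y) = (0, X)"
proof -
  have lin: "linear (\<lambda>X. snd (blinfun_apply \<sigma> (0, X)))"
    by (rule bounded_linear.linear[OF bounded_linear_compose[OF bounded_linear_snd
          bounded_linear_compose[OF blinfun.bounded_linear_right
            bounded_linear_Pair[OF bounded_linear_zero bounded_linear_ident]]]])
  have "inj (\<lambda>X. snd (blinfun_apply \<sigma> (0, X)))"
    unfolding linear_injective_0[OF lin]
  proof (intro allI impI)
    fix X assume "snd (blinfun_apply \<sigma> (0, X)) = 0"
    then have "blinfun_apply \<sigma> (0, X) = 0" using Q_center[OF \<sigma>, of X] by (simp add: prod_eq_iff)
    then have "norm (0::'v, X) = 0" using norm_Q[OF \<sigma>, of "(0, X)"] by simp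
    then show "X = 0" by (simp add: norm_Pair)
  qed
  then have "surj (\<lambda>X. snd (blinfun_apply \<sigma> (0, X)))"
    by (rule linear_injective_imp_surjective[OF lin]) (rule refl)
  from surjD[OF this, of X] obtain Y where "snd (blinfun_apply \<sigma> (0, Y)) = X" by auto
  then show ?thesis using that[of Y] Q_center[OF \<sigma>, of Y] by (simp add: prod_eq_iff)
qed

text \<open>An isometry mapping \<open>z\<close> onto itself preserves the orthogonal complement
  \<open>v\<close>; test against a preimage of the unwanted component.\<close>

lemma snd_Q:
  assumes \<sigma>: "\<sigma> \<in> Q"
  shows "snd (blinfun_apply \<sigma> (u, 0)) = 0"
proof -
  obtain Y where Y: "blinfun_apply \<sigma> (0, Y) = (0, snd (blinfun_apply \<sigma> (u, 0)))"
    using Q_center_surj[OF \<sigma>] .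
  then have "inner (snd (blinfun_apply \<sigma> (u, 0))) (snd (blinfun_apply \<sigma> (u, 0))) = 0"
    using inner_Q[OF \<sigma>, of "(u, 0)" "(0, Y)"] by (simp add: inner_prod_def)
  then show ?thesis by simp
qed

lemma blinfun_apply_Q:
  assumes \<sigma>: "\<sigma> \<in> Q"
  shows "blinfun_apply \<sigma> (U, X) = (vact \<sigma> U, snd (blinfun_apply \<sigma> (0, X)))"
proof -
  have "blinfun_apply \<sigma> (U, X) = blinfun_apply \<sigma> (U, 0) + blinfun_apply \<sigma> (0, X)"
    by (simp flip: blinfun.add_right)
  then show ?thesis
    using snd_Q[OF \<sigma>, of U] Q_center[OF \<sigma>, of X] by (simp add: prod_eq_iff vact_def)
qed

text \<open>The restriction of \<open>\<sigma>\<close> to \<open>v\<close>, placed in the algebra in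
  which the theory of compact groups was developed.\<close>

definition vendo :: "(('v \<times> 'z) \<Rightarrow>\<^sub>L ('v \<times> 'z)) \<Rightarrow> 'v endo"
  where "vendo \<sigma> = Endo (fst_blinfun o\<^sub>L \<sigma> o\<^sub>L Blinfun (\<lambda>u. (u, 0)))"

lemma app_vendo [simp]: "app (vendo \<sigma>) u = vact \<sigma> u"
proof -
  have "bounded_linear (\<lambda>u::'v. (u, 0::'z))"
    by (intro bounded_linear_Pair bounded_linear_ident bounded_linear_zero)
  then show ?thesis
    by (simp add: vendo_def app.rep_eq Endo_inverse vact_def bounded_linear_Blinfun_apply)
qed

definition vgroup :: "'v endo set"
  where "vgroup = vendo ` Q"

lemma compact_vgroup: "compact vgroup"
  unfolding vgroup_def
proof (rule compact_continuous_image)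
  have "bounded Q"
    unfolding bounded_iff
    by (intro exI[of _ 1] ballI norm_blinfun_bound) (simp_all add: norm_Q)
  then show "compact Q" using Q_closed compact_eq_bounded_closed by blast
  let ?i = "Blinfun (\<lambda>u::'v. (u, 0::'z))"
  have "continuous_on Q (\<lambda>\<sigma>. fst_blinfun o\<^sub>L \<sigma> o\<^sub>L ?i)"
    by (intro continuous_intros)
  then show "continuous_on Q vendo"
    unfolding continuous_on_iff vendo_def by (simp add: dist_endo.rep_eq Endo_inverse)
qed

lemma ex_vgroup: "(\<exists>T\<in>vgroup. P (app T)) \<longleftrightarrow> (\<exists>\<sigma>\<in>Q. P (vact \<sigma>))"
proof -
  have "app (vendo \<sigma>) = vact \<sigma>" for \<sigma> by (rule ext) simp
  then show ?thesis by (simp add: vgroup_def)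
qed

sublocale K: compact_isometry_group vgroup
proof
  show "compact vgroup" by (rule compact_vgroup)
  have "vendo id_blinfun = 1" by (rule endo_eqI) (simp add: vact_def)
  then show "1 \<in> vgroup" using imageI[OF Q_id, of vendo] by (simp add: vgroup_def)
  \<comment> \<open>Restriction to \<open>v\<close> is multiplicative because elements of
    \<open>Q\<close> preserve \<open>v\<close>.\<close>
  have comp: "vendo (\<sigma> o\<^sub>L \<tau>) = vendo \<sigma> * vendo \<tau>" if "\<sigma> \<in> Q" "\<tau> \<in> Q" for \<sigma> \<tau>
  proof (rule endo_eqI)
    fix u
    have "blinfun_apply \<tau> (u, 0) = (vact \<tau> u, 0)"
      using snd_Q[OF that(2), of u] by (simp add: prod_eq_iff vact_def)
    then have "vact (\<sigma> o\<^sub>L \<tau>) u = vact \<sigma> (vact \<tau> u)" by (simp add: vact_def[of \<sigma>] vact_def[of "\<sigma> o\<^sub>L \<tau>"])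
    then show "app (vendo (\<sigma> o\<^sub>L \<tau>)) u = app (vendo \<sigma> * vendo \<tau>) u" by simp
  qed
  show "S * T \<in> vgroup" if ST: "S \<in> vgroup" "T \<in> vgroup" for S T
  proof -
    obtain \<sigma> \<tau> where "\<sigma> \<in> Q" "S = vendo \<sigma>" "\<tau> \<in> Q" "T = vendo \<tau>"
      using ST by (auto simp: vgroup_def)
    then show ?thesis using imageI[OF Q_comp[of \<sigma> \<tau>], of vendo] by (simp add: comp vgroup_def)
  qed
  show "\<exists>S\<in>vgroup. S * T = 1" if T: "T \<in> vgroup" for T
  proof -
    obtain \<sigma> where \<sigma>: "\<sigma> \<in> Q" "T = vendo \<sigma>" using T by (auto simp: vgroup_def)
    obtain \<tau> where \<tau>: "\<tau> \<in> Q" "\<tau> o\<^sub>L \<sigma> = id_blinfun" using Q_inv[OF \<sigma>(1)] by blast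
    have "vendo \<tau> * T = 1" using comp[OF \<tau>(1) \<sigma>(1)] \<tau>(2) \<sigma>(2) \<open>vendo id_blinfun = 1\<close> by simp
    then show ?thesis using \<tau>(1) by (auto simp: vgroup_def)
  qed
  show "norm (app T x) = norm x" if T: "T \<in> vgroup" for T x
  proof -
    obtain \<sigma> where \<sigma>: "\<sigma> \<in> Q" "T = vendo \<sigma>" using T by (auto simp: vgroup_def)
    have "blinfun_apply \<sigma> (x, 0) = (vact \<sigma> x, 0)"
      using snd_Q[OF \<sigma>(1), of x] by (simp add: prod_eq_iff vact_def)
    then show ?thesis using norm_Q[OF \<sigma>(1), of "(x, 0)"] \<sigma>(2) by (simp add: norm_Pair)
  qed
qed

section \<open>Invariance of \<open>w\<close> and description of the orbits\<close>

lemma app_w: "T \<in> vgroup \<Longrightarrow> x \<in> w \<Longrightarrow> app T x \<in> w"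
  using Q_w by (auto simp: vgroup_def)

lemma app_w_surj:
  assumes "T \<in> vgroup" "x \<in> w"
  obtains y where "y \<in> w" "app T y = x"
proof -
  obtain S where S: "S \<in> vgroup" "S * T = 1" "T * S = 1" using K.ex_inverse[OF assms(1)] .
  show ?thesis
  proof
    show "app S x \<in> w" using app_w[OF S(1) assms(2)] .
    show "app T (app S x) = x" using S(3) by (simp flip: app_mult)
  qed
qed

lemma app_vperp:
  assumes T: "T \<in> vgroup" and u: "u \<in> vperp w"
  shows "app T u \<in> vperp w"
  unfolding vperp_def
proof (intro CollectI ballI)
  fix x assume x: "x \<in> w"
  obtain y where y: "y \<in> w" "app T y = x" using app_w_surj[OF T x] .
  then show "inner (app T u) x = 0" using K.inner_app[OF T, of u y] u by (simp add: vperp_def)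
qed

lemma lie_vperp:
  assumes B: "B \<in> K.lie" and u: "u \<in> vperp w"
  shows "app B u \<in> vperp w"
  unfolding vperp_def
proof (intro CollectI ballI)
  fix x assume x: "x \<in> w"
  have "((\<lambda>t. inner (app (exp (t *\<^sub>R B)) u) x) has_vector_derivative inner (app B u) x) (at 0)"
    by (rule bounded_linear.has_vector_derivative[OF bounded_linear_inner_left K.app_lie_has_vector_derivative])
  moreover have "inner (app (exp (t *\<^sub>R B)) u) x = 0" for t
    using app_vperp[OF K.exp_lie[OF B] u] x by (simp add: vperp_def)
  ultimately have *: "((\<lambda>t::real. 0) has_vector_derivative inner (app B u) x) (at 0)" by simp
  show "inner (app B u) x = 0"
    using vector_derivative_unique_at[OF * has_vector_derivative_const] .
qed

lemma subspace_vperp: "subspace (vperp w)"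
  unfolding vperp_def by (simp add: subspace_def inner_add_left)

text \<open>The center is contained in the Lie algebra of \<open>H\<close>, so orbits are full in the \<open>z\<close>-direction.\<close>

lemma QH_orbit_iff:
  "p' \<in> QH_orbit br Q w p \<longleftrightarrow> snd p' = snd p \<and> (\<exists>T\<in>vgroup. fst (fst p') - app T (fst (fst p)) \<in> w)"
proof -
  obtain U X a where p: "p = ((U, X), a)" by (metis surj_pair)
  obtain U' X' a' where p': "p' = ((U', X'), a')" by (metis surj_pair)
  have mult: "smult br ((u, x), 0) p = ((u + U, x + X + (1/2) *\<^sub>R br u U), a)" for u x
    by (simp add: smult_def p)
  have "p' \<in> QH_orbit br Q w p \<longleftrightarrow> a' = a \<and> (\<exists>\<sigma>\<in>Q. U' - vact \<sigma> U \<in> w)"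
  proof
    assume "p' \<in> QH_orbit br Q w p"
    then obtain \<sigma> u x where h: "\<sigma> \<in> Q" "u \<in> w" "p' = sact \<sigma> (smult br ((u, x), 0) p)"
      unfolding QH_orbit_def Hgrp_def by blast
    then have "p' = ((vact \<sigma> (u + U), snd (blinfun_apply \<sigma> (0, x + X + (1/2) *\<^sub>R br u U))), a)"
      by (simp add: mult sact_def blinfun_apply_Q[OF h(1), of "u + U"])
    then have "a' = a" "U' = vact \<sigma> (u + U)" by (simp_all add: p')
    moreover have "vact \<sigma> (u + U) - vact \<sigma> U = vact \<sigma> u"
      by (simp flip: app_vendo app.diff_right)
    ultimately have "U' - vact \<sigma> U \<in> w" using Q_w[OF h(1,2)] by simp
    then show "a' = a \<and> (\<exists>\<sigma>\<in>Q. U' - vact \<sigma> U \<in> w)" using h(1) \<open>a' = a\<close> by blast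
  next
    assume "a' = a \<and> (\<exists>\<sigma>\<in>Q. U' - vact \<sigma> U \<in> w)"
    then obtain \<sigma> where \<sigma>: "a' = a" "\<sigma> \<in> Q" "U' - vact \<sigma> U \<in> w" by blast
    obtain u where u: "u \<in> w" "vact \<sigma> u = U' - vact \<sigma> U"
    proof (rule app_w_surj[of "vendo \<sigma>"])
      show "vendo \<sigma> \<in> vgroup" using \<sigma>(2) by (simp add: vgroup_def)
    qed (use \<sigma>(3) in auto)
    obtain Y where Y: "blinfun_apply \<sigma> (0, Y) = (0, X')" using Q_center_surj[OF \<sigma>(2)] .
    \<comment> \<open>The \<open>z\<close>-component is chosen to turn that of the product into
      \<open>Y\<close>, which \<open>\<sigma>\<close> sends to the prescribed
      \<open>X'\<close>.\<close>
    let ?h = "((u, Y - X - (1/2) *\<^sub>R br u U), 0)"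
    have "vact \<sigma> (u + U) = U'"
      using u(2) by (simp flip: app_vendo add: app.add_right)
    then have "p' = sact \<sigma> (smult br ?h p)"
      using Y \<sigma>(1) by (simp add: mult sact_def p' blinfun_apply_Q[OF \<sigma>(2), of "u + U"])
    moreover have "?h \<in> Hgrp w" using u(1) by (auto simp: Hgrp_def)
    ultimately show "p' \<in> QH_orbit br Q w p" unfolding QH_orbit_def using \<sigma>(2) by blast
  qed
  then show ?thesis using ex_vgroup[of "\<lambda>f. U' - f U \<in> w"] by (simp add: p p')
qed

lemma mem_Q_vorbit_iff: "v \<in> Q_vorbit Q u \<longleftrightarrow> (\<exists>T\<in>vgroup. v = app T u)"
  using ex_vgroup[of "\<lambda>f. v = f u"] by (auto simp: Q_vorbit_def)

lemma subalgebra_hsub: "subalgebra br (hsub w :: ('v, 'z) spt set)"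
proof -
  have "hsub w = {p :: ('v, 'z) spt. fst (fst p) \<in> w \<and> snd p = 0}"
    by (auto simp: hsub_def)
  then show ?thesis
    using w_sub subspace_0[OF w_sub]
    by (simp add: subalgebra_def subspace_def sbr_def nbr_def)
qed

text \<open>The orthogonal projection onto \<open>vperp w\<close>; the two conditions determine it,
  see \<open>\<pi>_eqI\<close>.\<close>

definition \<pi> :: "'v \<Rightarrow> 'v"
  where "\<pi> = (SOME \<pi>. linear \<pi> \<and> (\<forall>x. \<pi> x \<in> vperp w \<and> x - \<pi> x \<in> w))"

lemma \<pi>: "linear \<pi>" "\<pi> x \<in> vperp w" "x - \<pi> x \<in> w"
proof -
  obtain P where P: "linear P" "\<And>x. P x \<in> w" "\<And>x y. y \<in> w \<Longrightarrow> inner (x - P x) y = 0"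
    using subspace_projection[OF w_sub] by metis
  have "linear (\<lambda>x. x - P x)" using P(1) by (intro linear_compose_sub linear_ident)
  then have "\<exists>\<pi>. linear \<pi> \<and> (\<forall>x. \<pi> x \<in> vperp w \<and> x - \<pi> x \<in> w)"
    using P by (intro exI[of _ "\<lambda>x. x - P x"]) (simp add: vperp_def)
  from someI_ex[OF this] show "linear \<pi>" "\<pi> x \<in> vperp w" "x - \<pi> x \<in> w"
    unfolding \<pi>_def by blast+
qed

lemma \<pi>_eqI:
  assumes "y \<in> vperp w" "x - y \<in> w"
  shows "\<pi> x = y"
proof -
  have "\<pi> x - y \<in> vperp w" using subspace_diff[OF subspace_vperp \<pi>(2) assms(1)] .
  moreover have "\<pi> x - y \<in> w"
    using subspace_diff[OF w_sub assms(2) \<pi>(3)[of x]] by simp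
  ultimately have "inner (\<pi> x - y) (\<pi> x - y) = 0" by (simp add: vperp_def)
  then show ?thesis by simp
qed

lemma \<pi>_vperp [simp]: "x \<in> vperp w \<Longrightarrow> \<pi> x = x"
  using \<pi>_eqI[of x x] subspace_0[OF w_sub] by simp

text \<open>The group preserves both \<open>w\<close> and \<open>vperp w\<close>, so orbits modulo
  \<open>w\<close> are orbits of the projections.\<close>

lemma \<pi>_app_iff:
  assumes "T \<in> vgroup"
  shows "x - app T y \<in> w \<longleftrightarrow> \<pi> x = app T (\<pi> y)"
proof -
  have "app T (y - \<pi> y) \<in> w" using app_w[OF assms \<pi>(3)] .
  then have T: "app T y - app T (\<pi> y) \<in> w" by (simp add: app.diff_right)
  show ?thesis
  proof
    assume "x - app T y \<in> w"
    from subspace_add[OF w_sub this T] show "\<pi> x = app T (\<pi> y)"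
      by (intro \<pi>_eqI app_vperp assms \<pi>(2)) simp
  next
    assume "\<pi> x = app T (\<pi> y)"
    with \<pi>(3)[of x] subspace_diff[OF w_sub _ T, of "x - app T (\<pi> y)"] show "x - app T y \<in> w" by simp
  qed
qed

section \<open>From a linear section to a section of the action on S\<close>

text \<open>The condition on \<open>J\<close> says that \<open>l\<close> is abelian. Hence the
  linear set of all \<open>((u, 0), a)\<close> with \<open>u\<close> in \<open>l\<close> is
  horizontal for the metric: the term \<open>[u, du]\<close> vanishes along it.\<close>

lemma polar_QH_if:
  assumes l: "linear_polar_section Q (vperp w) l"
    and J0: "\<And>X u u'. u \<in> l \<Longrightarrow> u' \<in> l \<Longrightarrow> inner (J X u) u' = 0"
  shows "polar_QH br Q w"
proof -
  have l': "subspace l" "l \<subseteq> vperp w" "(\<Union>u\<in>l. Q_vorbit Q u) = vperp w"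
    "\<And>u \<xi> \<eta>. u \<in> l \<Longrightarrow> \<xi> \<in> tangent_vecs (Q_vorbit Q u) u \<Longrightarrow> \<eta> \<in> l \<Longrightarrow> inner \<xi> \<eta> = 0"
    using l unfolding linear_polar_section_def by blast+
  define \<Sigma> :: "('v, 'z) spt set" where "\<Sigma> = {p. fst (fst p) \<in> l \<and> snd (fst p) = 0}"
  have sub: "subspace \<Sigma>"
    using l'(1) by (simp add: \<Sigma>_def subspace_def)
  have br0: "br u u' = 0" if "u \<in> l" "u' \<in> l" for u u'
  proof -
    have "inner (br u u') (br u u') = 0" using J0[OF that] J_def[of "br u u'" u u'] by simp
    then show ?thesis by simp
  qed
  have orth: "smetric br p \<xi> \<eta> = 0"
    if p: "p \<in> \<Sigma>" and \<xi>: "\<xi> \<in> tangent_vecs (QH_orbit br Q w p) p" and \<eta>: "\<eta> \<in> tangent_vecs \<Sigma> p" for p \<xi> \<eta>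
  proof -
    obtain u a where ua: "p = ((u, 0), a)" "u \<in> l"
      using p by (metis (mono_tags) \<Sigma>_def mem_Collect_eq prod.collapse)
    have \<eta>\<Sigma>: "fst (fst \<eta>) \<in> l" "snd (fst \<eta>) = 0"
      using tangent_vecs_subspace[OF sub \<eta>] by (simp_all add: \<Sigma>_def)
    obtain \<gamma> where \<gamma>: "(\<gamma> has_vector_derivative \<xi>) (at 0)" "\<gamma> 0 = p" "\<And>t. \<gamma> t \<in> QH_orbit br Q w p"
      using tangent_vecsE[OF \<xi>] by blast
    have "((\<lambda>t. snd (\<gamma> t)) has_vector_derivative snd \<xi>) (at 0)"
      by (rule bounded_linear.has_vector_derivative[OF bounded_linear_snd \<gamma>(1)])
    moreover have "snd (\<gamma> t) = a" for t using \<gamma>(3)[of t] by (simp add: QH_orbit_iff ua)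
    ultimately have "((\<lambda>t. a) has_vector_derivative snd \<xi>) (at 0)" by simp
    from vector_derivative_unique_at[OF this has_vector_derivative_const] have \<xi>a: "snd \<xi> = 0" .
    have "bounded_linear (\<lambda>p :: ('v, 'z) spt. \<pi> (fst (fst p)))"
      using \<pi>(1) by (intro bounded_linear_compose[OF _ bounded_linear_fst_comp] bounded_linear_fst_comp bounded_linear_fst)
        (simp add: linear_conv_bounded_linear)
    \<comment> \<open>The projected curve runs in a \<open>Q\<close>-orbit, so its velocity is
      orthogonal to \<open>l\<close>; the rest of the velocity lies in \<open>w\<close> and is
      orthogonal to \<open>l\<close> as well.\<close>
    from bounded_linear.has_vector_derivative[OF this \<gamma>(1)]
    have "\<pi> (fst (fst \<xi>)) \<in> tangent_vecs (Q_vorbit Q u) u"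
    proof (rule tangent_vecsI)
      show "\<pi> (fst (fst (\<gamma> 0))) = u" using ua l'(2) by (simp add: \<gamma>(2) subset_iff)
      show "\<pi> (fst (fst (\<gamma> t))) \<in> Q_vorbit Q u" for t
        using \<gamma>(3)[of t] ua l'(2) \<pi>_app_iff by (auto simp: QH_orbit_iff mem_Q_vorbit_iff subset_iff)
    qed
    from l'(4)[OF ua(2) this \<eta>\<Sigma>(1)] have "inner (\<pi> (fst (fst \<xi>))) (fst (fst \<eta>)) = 0" .
    moreover have "inner (fst (fst \<xi>) - \<pi> (fst (fst \<xi>))) (fst (fst \<eta>)) = 0"
      using \<pi>(3)[of "fst (fst \<xi>)"] \<eta>\<Sigma>(1) l'(2) by (auto simp: vperp_def inner_commute)
    ultimately have "inner (fst (fst \<xi>)) (fst (fst \<eta>)) = 0" by (simp add: inner_diff_left)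
    then show ?thesis
      by (simp add: ua(1) smetric_eq[OF br_bilinear] \<xi>a \<eta>\<Sigma>(2) br0[OF ua(2) \<eta>\<Sigma>(1)])
  qed
  have "p \<in> (\<Union>p\<in>\<Sigma>. QH_orbit br Q w p)" for p :: "('v, 'z) spt"
  proof -
    obtain u where u: "u \<in> l" "\<pi> (fst (fst p)) \<in> Q_vorbit Q u"
      using \<pi>(2)[of "fst (fst p)"] l'(3) by blast
    then obtain T where T: "T \<in> vgroup" "\<pi> (fst (fst p)) = app T u"
      by (auto simp: mem_Q_vorbit_iff)
    have "((u, 0), snd p) \<in> \<Sigma>" using u(1) by (simp add: \<Sigma>_def)
    moreover have "fst (fst p) - app T u \<in> w"
      using \<pi>_app_iff[OF T(1), of "fst (fst p)" u] T(2) u(1) l'(2) by (simp add: subset_iff)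
    then have "p \<in> QH_orbit br Q w ((u, 0), snd p)"
      using T(1) by (auto simp: QH_orbit_iff)
    ultimately show ?thesis by blast
  qed
  then have "(\<Union>p\<in>\<Sigma>. QH_orbit br Q w p) = UNIV" by blast
  moreover have "connected \<Sigma>" "closed \<Sigma>" "embedded_submanifold \<Sigma>"
    using sub convex_connected subspace_imp_convex closed_subspace embedded_submanifold_subspace by blast+
  ultimately show ?thesis unfolding polar_QH_def using orth by blast
qed

section \<open>From a section of the action on S to a linear section\<close>

text \<open>Orthogonality is tested on three kinds of orbit curves. Central curves, with velocity
  equal to the defect \<open>?E\<close> itself, make the \<open>z\<close>-term of the metric vanish;
  curves along \<open>w\<close> and curves moving \<open>\<pi> U\<close> by \<open>exp (t B)\<close>
  then see only the inner product of \<open>v\<close>.\<close>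

lemma normal_vector_conditions:
  fixes p :: "('v, 'z) spt"
  assumes normal: "\<And>\<xi>. \<xi> \<in> tangent_vecs (QH_orbit br Q w p) p \<Longrightarrow> smetric br p \<xi> \<eta> = 0"
  shows "snd (fst \<eta>) = (1/2) *\<^sub>R br (fst (fst p)) (fst (fst \<eta>))"
    and "fst (fst \<eta>) \<in> vperp w"
    and "B \<in> K.lie \<Longrightarrow> inner (app B (\<pi> (fst (fst p)))) (fst (fst \<eta>)) = 0"
proof -
  obtain U X a where p: "p = ((U, X), a)" by (metis surj_pair)
  let ?E = "snd (fst \<eta>) - (1/2) *\<^sub>R br U (fst (fst \<eta>))"
  have tangent: "((v, x), 0) \<in> tangent_vecs (QH_orbit br Q w p) p"
    if c: "(c has_vector_derivative v) (at 0)" "c 0 = U" "\<And>t. \<exists>T\<in>vgroup. c t - app T U \<in> w" for c v x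
  proof (rule tangent_vecsI)
    show "((\<lambda>t. ((c t, X + t *\<^sub>R x), a)) has_vector_derivative ((v, x), 0)) (at 0)"
      by (intro has_vector_derivative_Pair c(1) has_vector_derivative_const) (auto intro!: derivative_eq_intros)
    show "((c t, X + t *\<^sub>R x), a) \<in> QH_orbit br Q w p" for t
      using c(3)[of t] by (simp add: QH_orbit_iff p)
  qed (simp add: c(2) p)
  have "((0, ?E), 0) \<in> tangent_vecs (QH_orbit br Q w p) p"
  proof (rule tangent[of "\<lambda>_. U"])
    show "\<exists>T\<in>vgroup. U - app T U \<in> w" using K.one subspace_0[OF w_sub] by (intro bexI[of _ 1]) simp_all
  qed simp_all
  from normal[OF this] have "inner ?E ?E = 0"
    by (simp add: p smetric_eq[OF br_bilinear] br.zero_right)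
  then have E: "?E = 0" by (simp only: inner_eq_zero_iff)
  then show "snd (fst \<eta>) = (1/2) *\<^sub>R br (fst (fst p)) (fst (fst \<eta>))" by (simp add: p)
  have v0: "inner v (fst (fst \<eta>)) = 0"
    if "(c has_vector_derivative v) (at 0)" "c 0 = U" "\<And>t. \<exists>T\<in>vgroup. c t - app T U \<in> w" for c v
    using normal[OF tangent[OF that, of 0]] by (simp add: p smetric_eq[OF br_bilinear] E)
  show "fst (fst \<eta>) \<in> vperp w"
    unfolding vperp_def
  proof (intro CollectI ballI)
    fix x assume x: "x \<in> w"
    have "inner x (fst (fst \<eta>)) = 0"
    proof (rule v0)
      show "((\<lambda>t. U + t *\<^sub>R x) has_vector_derivative x) (at 0)" by (auto intro!: derivative_eq_intros)
      show "\<exists>T\<in>vgroup. U + t *\<^sub>R x - app T U \<in> w" for t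
        using K.one subspace_scale[OF w_sub x] by (intro bexI[of _ 1]) simp_all
    qed simp
    then show "inner (fst (fst \<eta>)) x = 0" by (simp add: inner_commute)
  qed
  show "inner (app B (\<pi> (fst (fst p)))) (fst (fst \<eta>)) = 0" if B: "B \<in> K.lie"
    unfolding p fst_conv
  proof (rule v0)
    show "((\<lambda>t. (U - \<pi> U) + app (exp (t *\<^sub>R B)) (\<pi> U)) has_vector_derivative app B (\<pi> U)) (at 0)"
      using has_vector_derivative_add[OF has_vector_derivative_const K.app_lie_has_vector_derivative] by simp
    show "\<exists>T\<in>vgroup. (U - \<pi> U) + app (exp (t *\<^sub>R B)) (\<pi> U) - app T U \<in> w" for t
    proof (rule bexI)
      show T: "exp (t *\<^sub>R B) \<in> vgroup" using K.exp_lie[OF B] .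
      have "(U - \<pi> U) + app (exp (t *\<^sub>R B)) (\<pi> U) - app (exp (t *\<^sub>R B)) U
          = (U - \<pi> U) - app (exp (t *\<^sub>R B)) (U - \<pi> U)"
        by (simp add: app.diff_right)
      also have "\<dots> \<in> w" by (intro subspace_diff w_sub app_w T \<pi>(3))
      finally show "(U - \<pi> U) + app (exp (t *\<^sub>R B)) (\<pi> U) - app (exp (t *\<^sub>R B)) U \<in> w" .
    qed
  qed simp
qed

text \<open>\<open>l\<close> is the normal space of an orbit at a point provided by
  \<open>ex_large_chart\<close>; since tangent vectors of \<open>\<Sigma>\<close> cover
  \<open>l\<close> there, the second-order identities descend to \<open>l\<close>.\<close>

lemma section_if_polar_QH:
  assumes "polar_QH br Q w"
  shows "\<exists>l. linear_polar_section Q (vperp w) l \<and> (\<forall>X. \<forall>u\<in>l. \<forall>u'\<in>l. inner (J X u) u' = 0)"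
proof -
  obtain \<Sigma> where \<Sigma>: "embedded_submanifold \<Sigma>" "(\<Union>p\<in>\<Sigma>. QH_orbit br Q w p) = UNIV"
    "\<And>p \<xi> \<eta>. p \<in> \<Sigma> \<Longrightarrow> \<xi> \<in> tangent_vecs (QH_orbit br Q w p) p \<Longrightarrow> \<eta> \<in> tangent_vecs \<Sigma> p \<Longrightarrow> smetric br p \<xi> \<eta> = 0"
    using assms unfolding polar_QH_def by blast
  define chart where "chart q U V \<phi> \<psi> L \<longleftrightarrow> q \<in> U \<and> flattens \<Sigma> U L \<phi> \<psi> \<and> open V \<and> smooth_on V \<psi> \<and> \<phi> q \<in> V \<and>
    (\<forall>y\<in>V. linear (\<lambda>\<eta>. dderiv [\<eta>] \<psi> y)) \<and> (\<forall>y\<in>V. \<forall>\<eta>. dderiv [\<eta>] \<psi> y = 0 \<longrightarrow> \<eta> = 0) \<and>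
    (\<forall>y\<in>V \<inter> L. \<psi> y \<in> \<Sigma> \<and> (\<forall>\<eta>\<in>L. dderiv [\<eta>] \<psi> y \<in> tangent_vecs \<Sigma> (\<psi> y)))"
    for q :: "('v, 'z) spt" and U V and \<phi> \<psi> :: "('v, 'z) spt \<Rightarrow> ('v, 'z) spt" and L
  have "\<exists>U V \<phi> \<psi> L. chart q U V \<phi> \<psi> L" if "q \<in> \<Sigma>" for q
    by (rule embedded_submanifold_chart[OF \<Sigma>(1) that]) (unfold chart_def, blast)
  then obtain U V \<phi> \<psi> L where chart: "\<And>q. q \<in> \<Sigma> \<Longrightarrow> chart q (U q) (V q) (\<phi> q) (\<psi> q) (L q)"
    by metis
  have "\<exists>q\<in>\<Sigma>. dim (L q) + dim (K.lie_orbit (\<pi> (fst (fst q)))) > dim (vperp w)"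
  proof (rule K.ex_large_chart[where U = U and \<phi> = \<phi> and \<psi> = \<psi>])
    fix p :: "('v, 'z) spt"
    obtain q where "q \<in> \<Sigma>" "p \<in> QH_orbit br Q w q" using \<Sigma>(2) by blast
    then show "\<exists>T\<in>vgroup. \<exists>q\<in>\<Sigma>. \<pi> (fst (fst p)) = app T (\<pi> (fst (fst q))) \<and> snd p = snd q"
      unfolding QH_orbit_iff using \<pi>_app_iff by blast
    show "q \<in> U q \<and> flattens \<Sigma> (U q) (L q) (\<phi> q) (\<psi> q)" if "q \<in> \<Sigma>" for q
      using chart[OF that] unfolding chart_def by blast
  qed (simp_all add: w_sub \<pi>)
  then obtain q where q: "q \<in> \<Sigma>" "dim (L q) + dim (K.lie_orbit (\<pi> (fst (fst q)))) > dim (vperp w)"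
    by blast
  define u where "u = \<pi> (fst (fst q))"
  define x where "x = \<phi> q q"
  define D where "D \<eta> = dderiv [\<eta>] (\<psi> q) x" for \<eta>
  define l where "l = {y \<in> vperp w. \<forall>v\<in>K.lie_orbit u. orthogonal v y}"
  have flat: "q \<in> U q" "open (V q)" "smooth_on (V q) (\<psi> q)" "x \<in> V q"
      "flattens \<Sigma> (U q) (L q) (\<phi> q) (\<psi> q)"
    and linD: "linear D" and injD: "\<And>\<eta>. D \<eta> = 0 \<Longrightarrow> \<eta> = 0"
    and on: "\<And>y. y \<in> V q \<Longrightarrow> y \<in> L q \<Longrightarrow> \<psi> q y \<in> \<Sigma>"
    and tan: "\<And>y \<eta>. y \<in> V q \<Longrightarrow> y \<in> L q \<Longrightarrow> \<eta> \<in> L q \<Longrightarrow> dderiv [\<eta>] (\<psi> q) y \<in> tangent_vecs \<Sigma> (\<psi> q y)"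
    using chart[OF q(1)] unfolding chart_def x_def D_def[abs_def] by blast+
  have L: "subspace (L q)" and xL: "x \<in> L q" and \<psi>x: "\<psi> q x = q"
    using flat(1,5) q(1) unfolding flattens_def x_def by blast+
  have normal: "snd (fst (dderiv [\<eta>] (\<psi> q) y)) = (1/2) *\<^sub>R br (fst (fst (\<psi> q y))) (fst (fst (dderiv [\<eta>] (\<psi> q) y)))"
      "fst (fst (dderiv [\<eta>] (\<psi> q) y)) \<in> vperp w"
      "B \<in> K.lie \<Longrightarrow> inner (app B (\<pi> (fst (fst (\<psi> q y))))) (fst (fst (dderiv [\<eta>] (\<psi> q) y))) = 0"
    if "y \<in> V q" "y \<in> L q" "\<eta> \<in> L q" for y \<eta> B
    using normal_vector_conditions[of "\<psi> q y" "dderiv [\<eta>] (\<psi> q) y", OF \<Sigma>(3)[OF on[OF that(1,2)] _ tan[OF that]]]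
    by blast+
  have ff: "bounded_linear (\<lambda>p :: ('v, 'z) spt. fst (fst p))"
    by (intro bounded_linear_fst_comp bounded_linear_fst)
  have sf: "bounded_linear (\<lambda>p :: ('v, 'z) spt. snd (fst p))"
    by (intro bounded_linear_snd_comp bounded_linear_fst)
  have \<pi>ff: "bounded_linear (\<lambda>p :: ('v, 'z) spt. \<pi> (fst (fst p)))"
    using bounded_linear_compose[OF _ ff] \<pi>(1) by (simp add: linear_conv_bounded_linear)
  \<comment> \<open>The bracket of tangent vectors is symmetric by
    \<open>second_order_symmetry\<close> and skew anyway. The factor 2 brings the horizontality
    condition into the form \<open>M = \<beta>\<close>.\<close>
  have commute: "br (fst (fst (D \<zeta>))) (fst (fst (D \<eta>))) = 0" if "\<zeta> \<in> L q" "\<eta> \<in> L q" for \<zeta> \<eta>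
  proof -
    have lin: "bounded_linear (\<lambda>p :: ('v, 'z) spt. 2 *\<^sub>R snd (fst p))"
      by (rule bounded_linear_compose[OF bounded_linear_scaleR_right sf])
    have eq: "2 *\<^sub>R snd (fst (dderiv [\<eta>] (\<psi> q) y)) = br (fst (fst (\<psi> q y))) (fst (fst (dderiv [\<eta>] (\<psi> q) y)))"
      if "y \<in> V q" "y \<in> L q" "\<eta> \<in> L q" for y \<eta>
      unfolding normal(1)[OF that] by simp
    from second_order_symmetry[OF flat(2,3) L lin ff br_bilinear eq flat(4) xL that]
    have "br (fst (fst (D \<zeta>))) (fst (fst (D \<eta>))) = br (fst (fst (D \<eta>))) (fst (fst (D \<zeta>)))"
      by (simp add: D_def)
    also have "\<dots> = - br (fst (fst (D \<zeta>))) (fst (fst (D \<eta>)))" by (rule br_skew)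
    finally have "2 *\<^sub>R br (fst (fst (D \<zeta>))) (fst (fst (D \<eta>))) = 0" by (simp add: scaleR_2 eq_neg_iff_add_eq_0)
    then show ?thesis by simp
  qed
  \<comment> \<open>The same argument with \<open>M = 0\<close>, now against the skewness of
    \<open>B\<close>. Applying \<open>\<pi>\<close> in both arguments allows one map
    \<open>N\<close>; tangent vectors are fixed by it.\<close>
  have killing: "inner (app B (fst (fst (D \<zeta>)))) (fst (fst (D \<eta>))) = 0"
    if B: "B \<in> K.lie" and L': "\<zeta> \<in> L q" "\<eta> \<in> L q" for B \<zeta> \<eta>
  proof -
    have bil: "bounded_bilinear (\<lambda>a b. inner (app B a) b)"
      by (rule bounded_bilinear.comp1[OF bounded_bilinear_inner app.bounded_linear_right])
    have eq: "0 = inner (app B (\<pi> (fst (fst (\<psi> q y))))) (\<pi> (fst (fst (dderiv [\<eta>] (\<psi> q) y))))"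
      if "y \<in> V q" "y \<in> L q" "\<eta> \<in> L q" for y \<eta>
      using normal(2,3)[OF that] B by simp
    have "inner (app B (\<pi> (fst (fst (D \<zeta>))))) (\<pi> (fst (fst (D \<eta>)))) = inner (app B (\<pi> (fst (fst (D \<eta>))))) (\<pi> (fst (fst (D \<zeta>))))"
      using second_order_symmetry[OF flat(2,3) L bounded_linear_zero \<pi>ff bil eq flat(4) xL L'] by (simp add: D_def)
    then have "inner (app B (fst (fst (D \<zeta>)))) (fst (fst (D \<eta>))) = inner (app B (fst (fst (D \<eta>)))) (fst (fst (D \<zeta>)))"
      using normal(2)[OF flat(4) xL L'(1)] normal(2)[OF flat(4) xL L'(2)] by (simp add: D_def)
    then show ?thesis using K.lie_skew[OF B, of "fst (fst (D \<eta>))" "fst (fst (D \<zeta>))"] by (simp add: inner_commute)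
  qed
  have sub_l: "subspace l"
    using subspace_vperp by (simp add: l_def subspace_def orthogonal_def inner_add_right)
  have "K.lie_orbit u \<subseteq> vperp w"
    using lie_vperp \<pi>(2) by (auto simp: K.lie_orbit_def u_def)
  from dim_subspace_orthogonal_to_vectors[OF K.subspace_lie_orbit subspace_vperp this]
  have dim_l: "dim l + dim (K.lie_orbit u) = dim (vperp w)" by (simp add: l_def)
  text \<open>The horizontal lift condition makes \<open>E\<close> injective; it is onto by the choice of \<open>q\<close>.\<close>
  define E where "E \<eta> = (fst (fst (D \<eta>)), snd (D \<eta>))" for \<eta>
  have linE: "linear E"
    by (rule linearI) (simp_all add: E_def linear_add[OF linD] linear_scale[OF linD])
  have injE: "inj_on E (span (L q))"
    unfolding linear_inj_on_iff_eq_0[OF linE subspace_span]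
  proof (intro ballI impI)
    fix \<eta> assume "\<eta> \<in> span (L q)" "E \<eta> = 0"
    then have \<eta>: "\<eta> \<in> L q" "fst (fst (D \<eta>)) = 0" "snd (D \<eta>) = 0"
      using L by (simp_all add: span_eq_iff[THEN iffD2] E_def zero_prod_def)
    have "snd (fst (D \<eta>)) = 0" using normal(1)[OF flat(4) xL \<eta>(1)] \<eta>(2) by (simp add: D_def br.zero_right)
    then have "D \<eta> = 0" using \<eta> by (simp add: prod_eq_iff)
    then show "\<eta> = 0" by (rule injD)
  qed
  \<comment> \<open>\<open>dim (L q)\<close> exceeds
    \<open>dim (vperp w) - dim (K.lie_orbit u) = dim l\<close>, so it reaches
    \<open>dim l + 1\<close>; the additional dimension is the direction of \<open>A\<close>.\<close>
  have "E ` L q = l \<times> UNIV"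
  proof (rule subspace_dim_equal)
    show "subspace (E ` L q)" using linE L linear_subspace_image by blast
    show "subspace (l \<times> (UNIV :: real set))" by (intro subspace_Times sub_l subspace_UNIV)
    show "E ` L q \<subseteq> l \<times> UNIV"
    proof (rule image_subsetI)
      fix \<eta> assume \<eta>: "\<eta> \<in> L q"
      show "E \<eta> \<in> l \<times> UNIV"
        using normal(2,3)[OF flat(4) xL \<eta>] \<psi>x by (auto simp: E_def l_def D_def u_def K.lie_orbit_def orthogonal_def)
    qed
    have "dim (E ` L q) = dim (L q)" by (rule dim_image_eq[OF linE injE])
    then show "dim (l \<times> (UNIV :: real set)) \<le> dim (E ` L q)"
      using q(2) dim_l by (simp add: dim_Times[OF sub_l subspace_UNIV] u_def)
  qed
  then have lift: "\<exists>\<eta>\<in>L q. fst (fst (D \<eta>)) = y" if "y \<in> l" for y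
  proof -
    have "(y, 0) \<in> E ` L q" using \<open>E ` L q = l \<times> UNIV\<close> that by simp
    then show ?thesis by (auto simp: E_def)
  qed
  have killing_l: "inner (app B y) y' = 0" if "B \<in> K.lie" "y \<in> l" "y' \<in> l" for B y y'
    using lift[OF that(2)] lift[OF that(3)] killing[OF that(1)] by blast
  have J_l: "inner (J X y) y' = 0" if "y \<in> l" "y' \<in> l" for X y y'
    using lift[OF that(1)] lift[OF that(2)] commute J_def[of X y y'] by (metis inner_zero_left)
  have "linear_polar_section Q (vperp w) l"
    unfolding linear_polar_section_def
  proof (intro conjI ballI sub_l)
    show "l \<subseteq> vperp w" by (auto simp: l_def)
    show "(\<Union>y\<in>l. Q_vorbit Q y) = vperp w"
    proof
      show "(\<Union>y\<in>l. Q_vorbit Q y) \<subseteq> vperp w"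
        using app_vperp by (auto simp: mem_Q_vorbit_iff l_def)
      show "vperp w \<subseteq> (\<Union>y\<in>l. Q_vorbit Q y)"
      proof
        fix y assume y: "y \<in> vperp w"
        obtain T where T: "T \<in> vgroup" "\<And>B. B \<in> K.lie \<Longrightarrow> inner (app T y) (app B u) = 0"
          using K.meets_normal_space[of y u] by blast
        have "app T y \<in> l"
          using app_vperp[OF T(1) y] T(2) by (auto simp: l_def K.lie_orbit_def orthogonal_def inner_commute)
        moreover obtain S where "S \<in> vgroup" "S * T = 1" "T * S = 1" using K.ex_inverse[OF T(1)] .
        then have "y \<in> Q_vorbit Q (app T y)"
          by (auto simp: mem_Q_vorbit_iff simp flip: app_mult intro!: bexI[of _ S])
        ultimately show "y \<in> (\<Union>y\<in>l. Q_vorbit Q y)" by blast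
      qed
    qed
    fix y \<xi> \<eta> assume y: "y \<in> l" and \<xi>: "\<xi> \<in> tangent_vecs (Q_vorbit Q y) y" and \<eta>: "\<eta> \<in> l"
    obtain \<gamma> where \<gamma>: "(\<gamma> has_vector_derivative \<xi>) (at 0)" "\<gamma> 0 = y" "\<And>t. \<gamma> t \<in> Q_vorbit Q y"
      using tangent_vecsE[OF \<xi>] by blast
    show "inner \<xi> \<eta> = 0"
    \<comment> \<open>Arbitrary orbit velocities at \<open>y\<close> are reduced to the vectors
      \<open>app B y\<close>, which \<open>killing_l\<close> handles.\<close>
    proof (rule K.orbit_tangent_orthogonal[OF _ \<gamma>(2,1)])
      show "\<exists>T\<in>vgroup. \<gamma> t = app T y" for t using \<gamma>(3)[of t] by (simp add: mem_Q_vorbit_iff)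
      show "inner (app B y) \<eta> = 0" if "B \<in> K.lie" for B using killing_l[OF that y \<eta>] .
    qed
  qed
  then show ?thesis using J_l by blast
qed

end

theorem theorem3p9:
  fixes br :: "'v::euclidean_space \<Rightarrow> 'v \<Rightarrow> 'z::euclidean_space"
    and J :: "'z \<Rightarrow> 'v \<Rightarrow> 'v"
    and w :: "'v set"
    and Q :: "(('v \<times> 'z) \<Rightarrow>\<^sub>L ('v \<times> 'z)) set"
  assumes br_bilinear: "bounded_bilinear br"
    and br_skew: "\<And>U V. br U V = - br V U"
    and J_def: "\<And>Z U V. inner (J Z U) V = inner (br U V) Z"
    and J_sq: "\<And>Z U. J Z (J Z U) = - (inner Z Z) *\<^sub>R U"
    and w_sub: "subspace w"
    and Q_closed: "closed Q"
    and Q_sub: "Q \<subseteq> AN0 br"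
    and Q_id: "id_blinfun \<in> Q"
    and Q_comp: "\<And>\<sigma> \<tau>. \<sigma> \<in> Q \<Longrightarrow> \<tau> \<in> Q \<Longrightarrow> \<sigma> o\<^sub>L \<tau> \<in> Q"
    and Q_inv: "\<And>\<sigma>. \<sigma> \<in> Q \<Longrightarrow> \<exists>\<tau>\<in>Q. \<tau> o\<^sub>L \<sigma> = id_blinfun"
    and Q_w: "\<And>\<sigma> u. \<sigma> \<in> Q \<Longrightarrow> u \<in> w \<Longrightarrow> vact \<sigma> u \<in> w"
  shows "subalgebra br (hsub w :: ('v,'z) spt set) \<and>
         (polar_QH br Q w \<longleftrightarrow>
          (\<exists>l. linear_polar_section Q (vperp w) l \<and>
               (\<forall>X. \<forall>u\<in>l. \<forall>u'\<in>l. inner (J X u) u' = 0)))"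
proof -
  interpret damek_ricci_action br J w Q
    by (rule damek_ricci_action.intro) (fact assms)+
  show ?thesis
    using subalgebra_hsub polar_QH_if section_if_polar_QH by blast
qed

end
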